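(* Let $\boldsymbol{X}$ be a Poisson process with unknown intensity $s$ with respect to the Lebesgue measure on $[0,1)^k$. For $m=(\boldsymbol{N},r)\in\mathcal{M}=(\mathbb{N}^\star)^k\times\mathbb{N}$ with $\boldsymbol{N}=(N_1,\dots,N_k)$, let $\mathcal{I}_{\boldsymbol{N}}$ be the partition of $[0,1)^k$ into $\prod_{j=1}^kN_j$ translates of the hyperrectangle $\prod_{j=1}^k[0,N_j^{-1})$, let $\overline{S}_m$ be the linear space of piecewise polynomials on the partition $\mathcal{I}_{\boldsymbol{N}}$ with degree at most $r$ with respect to each variable, of dimension $\overline{D}_m=(r+1)^k\prod_{j=1}^kN_j$, and let $\Delta_m=\overline{D}_m$. Let $\hat s$ be a T-estimator based on the family of linear models $\{\overline{S}_m, m\in\mathcal{M}\}$ with weights $\Delta_m$. Assume that $\sqrt{s}$ belongs to the anisotropic H\"older class $\mathcal{H}(\boldsymbol\alpha,\boldsymbol{R})$, $\boldsymbol\alpha=(\alpha_1,\dots,\alpha_k)$, $\boldsymbol{R}=(R_1,\dots,R_k)\in(0,+\infty)^k$, and set $$\overline\alpha=\left(k^{-1}\sum_{j=1}^k\alpha_j^{-1}\right)^{-1}\quad\text{and}\quad\overline{R}=\left(\prod_{j=1}^kR_j^{1/\alpha_j}\right)^{\overline\alpha/k}.$$ If $R_j\ge\overline{R}^{k/(2\overline\alpha+k)}$ for all $j$, then $$\mathbb{E}_s\left[H^2(s,\hat s)\right]\le C(k,\boldsymbol\alpha)\,\overline{R}^{2k/(2\overline\alpha+k)},$$ where $C(k,\boldsymbol\alpha)$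 depends only on $k$ and $\boldsymbol\alpha$.
   Context: $\lambda$ is Lebesgue measure on $\mathcal{X}=[0,1)^k$, $\|\cdot\|_2$ the norm of $\mathbb{L}_2(\lambda)$, $\mathbb{L}_1^+(\lambda)$ the nonnegative elements of $\mathbb{L}_1(\lambda)$; $\mathbb{N}=\{0,1,\dots\}$, $\mathbb{N}^\star=\mathbb{N}\setminus\{0\}$; $a\vee b=\max(a,b)$. A Poisson process with intensity $s\in\mathbb{L}_1^+(\lambda)$ is a point process $\boldsymbol{X}=\{X_1,\dots,X_N\}$ with $N$ Poisson with parameter $\int s\,d\lambda$ and, conditionally on $N$, the $X_i$ i.i.d. with density $s/\int s\,d\lambda$; $\mathbb{E}_s$ is the corresponding expectation. $\mathbb{P}_\mu$ refers to a Poisson process with finite mean measure $\mu$. For finite measures $H^2(\mu,\mu')=\frac12\int(\sqrt{d\mu/d\nu}-\sqrt{d\mu'/d\nu})^2d\nu$ ($\nu$ any dominating measure); $\mu_t=t\cdot\lambda$, $H(t,u)=H(\mu_t,\mu_u)=2^{-1/2}\|\sqrt t-\sqrt u\|_2$, $H(t,S')=\inf_{u\in S'}H(t,u)$. H\"older classes. A function $f$ on $[0,1)$ belongs to $\mathcal{H}(\alpha,R)$ with $\alpha=\beta+p$, $p\in\mathbb{N}$, $0<\beta\le1$, $R>0$, if it has a derivative of order $p$ satisfying $|f^{(p)}(x)-f^{(p)}(y)|\le R|x-y|^\beta$ for all $x,y\in[0,1)$. For $\boldsymbol\alpha,\boldsymbol{R}\in(0,+\infty)^k$, $\mathcal{H}(\boldsymbol\alpha,\boldsymbol{R})$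 is the set of functions $f$ on $[0,1)^k$ such that, for each $j$ and each choice of the $k-1$ other coordinates, $y\mapsto f(x_1,\dots,x_{j-1},y,x_{j+1},\dots,x_k)$ belongs to $\mathcal{H}(\alpha_j,R_j)$. T-estimators. A subset $S'$ of a metric space $(M,d)$ is a D-model with parameters $\eta,D,B'>0$ if $|S'\cap\mathcal{B}(t,x\eta)|\le B'\exp[Dx^2]$ for all $x\ge2$, $t\in M$ (open balls). Given a countable family of D-models $S_m$ in $(\mathbb{L}_1^+(\lambda),H)$ with parameters $\eta_m,D_m,B'$ such that $D_m\ge1/2$, $\eta_m^2\ge84D_m/5$, $\sum_m\exp[-\eta_m^2/84]<\infty$, let $S=\bigcup_mS_m$ and $\eta(t)=\inf\{\eta_m : S_m\ni t\}$. For each pair of distinct $t,u\in S$ take a test $\psi_{t,u}(\boldsymbol{X})\in\{t,u\}$ with $\mathbb{P}_\mu[\psi_{t,u}=u]\le\exp[-(H^2(t,u)-\eta^2(t)+\eta^2(u))/4]$ whenever $H(\mu,\mu_t)\le H(t,u)/4$, $\mathbb{P}_\mu[\psi_{t,u}=t]\le\exp[-(H^2(t,u)-\eta^2(u)+\eta^2(t))/4]$ whenever $H(\mu,\mu_u)\le H(t,u)/4$, and $\mathbb{P}_\mu[\psi_{t,u}=u]\le\exp[(16H^2(\mu,\mu_t)+\eta^2(t)-\eta^2(u))/4]$ for all finite measures $\mu$ (such tests exist). A T-estimator derived from $\{S_m\}$ is a measurable minimizer over $t\in S$ of $\mathcal{D}_{\boldsymbol{X}}(t)=\sup\{H(t,u)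 : u\in S,u\ne t,\psi_{t,u}(\boldsymbol{X})=u\}$ ($\sup\emptyset=0$). T-estimator based on linear models $\overline{S}_m\subset\mathbb{L}_2(\lambda)$ of dimensions $\overline{D}_m$ and weights $\Delta_m\ge0$ with $\sum_m\exp[-\Delta_m]<\infty$: put $\eta_m^2=84[\Delta_m\vee(9\overline{D}_m/5)]$, choose for each $m$ a D-model $S_m$ in $(\mathbb{L}_1^+(\lambda),H)$ with parameters $\eta_m$, $9\overline{D}_m$, $1$ such that $H(t,S_m)\le2.2[\inf_{u\in\overline{S}_m}\|\sqrt t-u\|_2+\eta_m]$ for all $t\in\mathbb{L}_1^+(\lambda)$ (such sets exist), and take a T-estimator derived from $\{S_m\}$. *)

theory Defs
  imports "HOL-Probability.Probability"
begin

section \<open>Hellinger distance between finite measures\<close>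

definition sum_measure :: "'a measure \<Rightarrow> 'a measure \<Rightarrow> 'a measure" where
  "sum_measure \<mu> \<mu>' = measure_of (space \<mu>) (sets \<mu>) (\<lambda>A. emeasure \<mu> A + emeasure \<mu>' A)"

text \<open>
  The integral below does not depend on the dominating measure; \<open>\<mu> + \<mu>'\<close> is used as a
  canonical choice.  Lemma \<open>hellinger_density\<close> gives the formula for densities with respect
  to an arbitrary sigma-finite dominating measure.
\<close>

definition hellinger :: "'a measure \<Rightarrow> 'a measure \<Rightarrow> real" where
  "hellinger \<mu> \<mu>' =
     (let \<nu> = sum_measure \<mu> \<mu>' in
      sqrt ((1 / 2) * (\<integral>x. (sqrt (enn2real (RN_deriv \<nu> \<mu> x)) - sqrt (enn2real (RN_deriv \<nu> \<mu>' x)))\<^sup>2 \<partial>\<nu>)))"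

lemma space_sum_measure [simp]: "space (sum_measure \<mu> \<mu>') = space \<mu>"
  and sets_sum_measure [simp]: "sets (sum_measure \<mu> \<mu>') = sets \<mu>"
  by (simp_all add: sum_measure_def)

lemma emeasure_sum_measure:
  assumes "sets \<mu>' = sets \<mu>" "A \<in> sets \<mu>"
  shows "emeasure (sum_measure \<mu> \<mu>') A = emeasure \<mu> A + emeasure \<mu>' A"
  unfolding sum_measure_def
proof (rule emeasure_measure_of_sigma)
  show "sigma_algebra (space \<mu>) (sets \<mu>)" ..
  show "positive (sets \<mu>) (\<lambda>A. emeasure \<mu> A + emeasure \<mu>' A)"
    by (simp add: positive_def)
  show "countably_additive (sets \<mu>) (\<lambda>A. emeasure \<mu> A + emeasure \<mu>' A)"
  proof (rule countably_additiveI)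
    fix F :: "nat \<Rightarrow> 'a set"
    assume F: "range F \<subseteq> sets \<mu>" "disjoint_family F"
    have "(\<Sum>i. emeasure \<mu> (F i) + emeasure \<mu>' (F i)) = (\<Sum>i. emeasure \<mu> (F i)) + (\<Sum>i. emeasure \<mu>' (F i))"
      by (rule suminf_add[symmetric]) auto
    then show "(\<Sum>i. emeasure \<mu> (F i) + emeasure \<mu>' (F i)) = emeasure \<mu> (\<Union>(range F)) + emeasure \<mu>' (\<Union>(range F))"
      using F assms(1) by (simp add: suminf_emeasure)
  qed
  show "A \<in> sets \<mu>" by fact
qed

lemma hellinger_density:
  fixes f g :: "'a \<Rightarrow> real"
  assumes "sigma_finite_measure \<nu>"
    and [measurable]: "f \<in> borel_measurable \<nu>" "g \<in> borel_measurable \<nu>"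
    and f0: "\<And>x. x \<in> space \<nu> \<Longrightarrow> 0 \<le> f x" and g0: "\<And>x. x \<in> space \<nu> \<Longrightarrow> 0 \<le> g x"
  shows "hellinger (density \<nu> f) (density \<nu> g) = sqrt ((1 / 2) * (\<integral>x. (sqrt (f x) - sqrt (g x))\<^sup>2 \<partial>\<nu>))"
proof -
  interpret sigma_finite_measure \<nu> by fact
  define h where "h x = f x + g x" for x
  have [measurable]: "h \<in> borel_measurable \<nu>" unfolding h_def by measurable
  have h0: "0 \<le> h x" if "x \<in> space \<nu>" for x using f0 g0 that by (simp add: h_def)
  let ?\<sigma> = "sum_measure (density \<nu> f) (density \<nu> g)"
  have sigma: "?\<sigma> = density \<nu> h"
  proof (rule measure_eqI)
    fix A assume "A \<in> sets ?\<sigma>"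
    then have [measurable]: "A \<in> sets \<nu>" by simp
    have "emeasure (density \<nu> h) A = (\<integral>\<^sup>+x. ennreal (f x) * indicator A x + ennreal (g x) * indicator A x \<partial>\<nu>)"
      by (subst emeasure_density) (auto intro!: nn_integral_cong simp: h_def f0 g0 distrib_right)
    also have "\<dots> = emeasure (density \<nu> f) A + emeasure (density \<nu> g) A"
      by (subst nn_integral_add) (auto simp: emeasure_density)
    finally show "emeasure ?\<sigma> A = emeasure (density \<nu> h) A"
      by (simp add: emeasure_sum_measure)
  qed simp
  have key: "AE x in \<nu>. h x * enn2real (RN_deriv ?\<sigma> (density \<nu> p) x) = p x"
    if [measurable]: "p \<in> borel_measurable \<nu>" and p: "\<And>x. x \<in> space \<nu> \<Longrightarrow> 0 \<le> p x \<and> p x \<le> h x" for p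
  proof -
    have "density ?\<sigma> (\<lambda>x. ennreal (p x / h x)) = density \<nu> (\<lambda>x. ennreal (h x) * ennreal (p x / h x))"
      unfolding sigma by (rule density_density_eq) auto
    also have "\<dots> = density \<nu> p"
    proof (rule density_cong)
      show "AE x in \<nu>. ennreal (h x) * ennreal (p x / h x) = ennreal (p x)"
      proof (rule AE_I2)
        fix x assume x: "x \<in> space \<nu>"
        show "ennreal (h x) * ennreal (p x / h x) = ennreal (p x)"
          using p[OF x] h0[OF x] by (cases "h x = 0") (auto simp: ennreal_mult[symmetric])
      qed
    qed auto
    finally have "density ?\<sigma> (\<lambda>x. ennreal (p x / h x)) = density \<nu> p" .
    then have "density ?\<sigma> (RN_deriv ?\<sigma> (density \<nu> p)) = density \<nu> p"
      by (intro RN_derivI[where f="\<lambda>x. ennreal (p x / h x)"]) (auto simp: sigma)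
    moreover have R [measurable]: "RN_deriv ?\<sigma> (density \<nu> p) \<in> borel_measurable \<nu>"
      using borel_measurable_RN_deriv[of ?\<sigma> "density \<nu> p"]
      by (simp add: sigma)
    ultimately have "density \<nu> (\<lambda>x. ennreal (h x) * RN_deriv ?\<sigma> (density \<nu> p) x) = density \<nu> p"
      unfolding sigma by (subst (asm) density_density_eq) auto
    then have "AE x in \<nu>. ennreal (h x) * RN_deriv ?\<sigma> (density \<nu> p) x = ennreal (p x)"
      by (subst (asm) density_unique_iff) auto
    then show ?thesis
    proof (rule AE_mp, intro AE_I2 impI)
      fix x assume x: "x \<in> space \<nu>" and eq: "ennreal (h x) * RN_deriv ?\<sigma> (density \<nu> p) x = ennreal (p x)"
      have "enn2real (ennreal (h x) * RN_deriv ?\<sigma> (density \<nu> p) x) = p x"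
        using p[OF x] unfolding eq by simp
      then show "h x * enn2real (RN_deriv ?\<sigma> (density \<nu> p) x) = p x"
        using h0[OF x] by (simp add: enn2real_mult)
    qed
  qed
  define F where "F x = enn2real (RN_deriv ?\<sigma> (density \<nu> f) x)" for x
  define G where "G x = enn2real (RN_deriv ?\<sigma> (density \<nu> g) x)" for x
  have "RN_deriv ?\<sigma> N \<in> borel_measurable \<nu>" for N
    using borel_measurable_RN_deriv[of ?\<sigma> N] by (simp add: sigma)
  then have [measurable]: "F \<in> borel_measurable \<nu>" "G \<in> borel_measurable \<nu>"
    unfolding F_def G_def by auto
  have "(\<integral>x. (sqrt (F x) - sqrt (G x))\<^sup>2 \<partial>?\<sigma>) = (\<integral>x. h x *\<^sub>R (sqrt (F x) - sqrt (G x))\<^sup>2 \<partial>\<nu>)"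
    unfolding sigma by (rule integral_density) (auto intro!: AE_I2 h0)
  also have "\<dots> = (\<integral>x. (sqrt (f x) - sqrt (g x))\<^sup>2 \<partial>\<nu>)"
  proof (rule integral_cong_AE)
    have 1: "AE x in \<nu>. h x * F x = f x" and 2: "AE x in \<nu>. h x * G x = g x"
      unfolding F_def G_def by (rule key; use f0 g0 in \<open>auto simp: h_def\<close>)+
    have alg: "h x *\<^sub>R (sqrt a - sqrt b)\<^sup>2 = (sqrt (h x * a) - sqrt (h x * b))\<^sup>2" if "0 \<le> h x" for x a b
      using that by (simp add: real_sqrt_mult right_diff_distrib[symmetric] power_mult_distrib)
    show "AE x in \<nu>. h x *\<^sub>R (sqrt (F x) - sqrt (G x))\<^sup>2 = (sqrt (f x) - sqrt (g x))\<^sup>2"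
      using 1 2 AE_space
    proof eventually_elim
      case (elim x)
      then show ?case using alg[OF h0[of x]] by simp
    qed
  qed auto
  finally show ?thesis
    by (simp add: hellinger_def Let_def F_def G_def)
qed


section \<open>Poisson processes\<close>

text \<open>
  A configuration is a finite multiset of points; its sigma-algebra is the one generated by the
  numbers of points in measurable sets.
\<close>

definition config_space :: "'a measure \<Rightarrow> 'a multiset measure" where
  "config_space M =
     sigma {X. set_mset X \<subseteq> space M}
       {{X. set_mset X \<subseteq> space M \<and> size {#x \<in># X. x \<in> A#} = n} | A n. A \<in> sets M}"

text \<open>
  Law of the Poisson process with finite mean measure \<open>\<mu>\<close>.  The case of total mass zero, in which
  the process is empty, is separated because \<^const>\<open>poisson_pmf\<close> expects a positive parameter.
\<close>

definition poisson_process :: "'a measure \<Rightarrow> 'a multiset measure" where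
  "poisson_process \<mu> =
     (if measure \<mu> (space \<mu>) = 0 then return (config_space \<mu>) {#}
      else measure_pmf (poisson_pmf (measure \<mu> (space \<mu>))) \<bind>
        (\<lambda>n. distr (\<Pi>\<^sub>M i\<in>{..<n}. scale_measure (inverse (emeasure \<mu> (space \<mu>))) \<mu>)
               (config_space \<mu>) (\<lambda>x. image_mset x (mset_set {..<n}))))"

lemma space_config_space: "space (config_space M) = {X. set_mset X \<subseteq> space M}"
  unfolding config_space_def by (rule space_measure_of) auto

lemma sets_poisson_process [simp]: "sets (poisson_process \<mu>) = sets (config_space \<mu>)"
proof -
  have "sets (measure_pmf p \<bind>
      (\<lambda>n. distr (\<Pi>\<^sub>M i\<in>{..<n}. N) (config_space \<mu>) (\<lambda>x. image_mset x (mset_set {..<n})))) =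
    sets (config_space \<mu>)" for p N
    by (rule sets_bind) simp_all
  then show ?thesis
    by (simp only: poisson_process_def sets_return if_cancel split: if_split) blast
qed

lemma measurable_mset_config_space:
  "(\<lambda>x. image_mset x (mset_set {..<n::nat})) \<in> (\<Pi>\<^sub>M i\<in>{..<n}. M) \<rightarrow>\<^sub>M config_space M"
  unfolding config_space_def
proof (rule measurable_measure_of)
  let ?f = "\<lambda>x :: nat \<Rightarrow> 'a. image_mset x (mset_set {..<n})" and ?P = "\<Pi>\<^sub>M i\<in>{..<n}. M"
  show "{{X. set_mset X \<subseteq> space M \<and> size {#x \<in># X. x \<in> A#} = n} |A n. A \<in> sets M}
    \<subseteq> Pow {X. set_mset X \<subseteq> space M}" by auto
  have f: "set_mset (?f x) \<subseteq> space M" if "x \<in> space ?P" for x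
    using that by (auto simp: space_PiM PiE_iff)
  then show "?f \<in> space ?P \<rightarrow> {X. set_mset X \<subseteq> space M}" by blast
  fix y assume "y \<in> {{X. set_mset X \<subseteq> space M \<and> size {#x \<in># X. x \<in> A#} = n} |A n. A \<in> sets M}"
  then obtain A m where [measurable]: "A \<in> sets M"
    and y: "y = {X. set_mset X \<subseteq> space M \<and> size {#x \<in># X. x \<in> A#} = m}" by blast
  have size: "size {#z \<in># image_mset x (mset_set {..<k}). z \<in> A#} = (\<Sum>i<k. if x i \<in> A then 1 else 0)"
    for x :: "nat \<Rightarrow> 'a" and k :: nat
    by (induction k) (simp_all add: lessThan_Suc)
  have "?f -` y \<inter> space ?P = {x \<in> space ?P. size {#z \<in># ?f x. z \<in> A#} = m}"
    using f unfolding y by blast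
  also have "\<dots> = {x \<in> space ?P. (\<Sum>i<n. if x i \<in> A then 1 else 0) = m}"
    by (simp only: size)
  also have "\<dots> \<in> sets ?P" by measurable
  finally show "?f -` y \<inter> space ?P \<in> sets ?P" .
qed

lemma prob_space_poisson_process:
  assumes "finite_measure \<mu>"
  shows "prob_space (poisson_process \<mu>)"
proof (cases "measure \<mu> (space \<mu>) = 0")
  case True
  then show ?thesis unfolding poisson_process_def
    by (auto intro!: prob_space_return simp: space_config_space)
next
  case False
  interpret finite_measure \<mu> by fact
  let ?N = "scale_measure (inverse (emeasure \<mu> (space \<mu>))) \<mu>"
  have e0: "emeasure \<mu> (space \<mu>) \<noteq> 0" using False by (auto simp: measure_def)
  have N: "prob_space ?N"
  proof (rule prob_spaceI)
    have "emeasure \<mu> (space \<mu>) / emeasure \<mu> (space \<mu>) = 1"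
      by (rule ennreal_divide_self) (use e0 in \<open>auto simp: emeasure_eq_measure\<close>)
    then show "emeasure ?N (space ?N) = 1"
      by (simp only: space_scale_measure emeasure_scale_measure divide_ennreal_def mult.commute)
  qed
  have c: "config_space ?N = config_space \<mu>" by (simp add: config_space_def space_scale_measure)
  have P: "prob_space (distr (\<Pi>\<^sub>M i\<in>{..<n::nat}. ?N) (config_space \<mu>) (\<lambda>x. image_mset x (mset_set {..<n})))" for n
    by (rule prob_space.prob_space_distr[OF prob_space_PiM]) (use N measurable_mset_config_space[of n ?N] c in auto)
  define K where "K = (\<lambda>n::nat. distr (\<Pi>\<^sub>M i\<in>{..<n}. ?N) (config_space \<mu>) (\<lambda>x. image_mset x (mset_set {..<n})))"
  have K: "K \<in> measure_pmf p \<rightarrow>\<^sub>M subprob_algebra (config_space \<mu>)" for p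
    using P by (simp add: K_def space_subprob_algebra Pi_iff prob_space_imp_subprob_space)
  have "prob_space (measure_pmf (poisson_pmf (measure \<mu> (space \<mu>))) \<bind> K)"
    by (rule measure_pmf.prob_space_bind[OF _ K]) (use P in \<open>simp add: K_def\<close>)
  then show ?thesis
    using False by (simp only: poisson_process_def K_def if_False)
qed


section \<open>Intensities on the unit cube\<close>

definition unit_cube :: "(real ^ 'n) set" where
  "unit_cube = {x. \<forall>j. 0 \<le> x $ j \<and> x $ j < 1}"

abbreviation cube_lebesgue :: "(real ^ 'n) measure" where
  "cube_lebesgue \<equiv> restrict_space lborel unit_cube"

text \<open>Elements of \<open>L\<^sub>1\<^sup>+\<close> and \<open>L\<^sub>2\<close> are represented by functions; only their values on the cube matter.\<close>

definition L1_nonneg :: "(real ^ 'n \<Rightarrow> real) set" where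
  "L1_nonneg = {t. integrable cube_lebesgue t \<and> (\<forall>x\<in>unit_cube. 0 \<le> t x)}"

definition L2_space :: "(real ^ 'n \<Rightarrow> real) set" where
  "L2_space = {f. f \<in> borel_measurable cube_lebesgue \<and> integrable cube_lebesgue (\<lambda>x. (f x)\<^sup>2)}"

definition L2_norm :: "(real ^ 'n \<Rightarrow> real) \<Rightarrow> real" where
  "L2_norm f = sqrt (\<integral>x. (f x)\<^sup>2 \<partial>cube_lebesgue)"

abbreviation intensity_measure :: "(real ^ 'n \<Rightarrow> real) \<Rightarrow> (real ^ 'n) measure" where
  "intensity_measure t \<equiv> density cube_lebesgue (\<lambda>x. ennreal (t x))"

definition hell :: "(real ^ 'n \<Rightarrow> real) \<Rightarrow> (real ^ 'n \<Rightarrow> real) \<Rightarrow> real" where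
  "hell t u = hellinger (intensity_measure t) (intensity_measure u)"

lemma space_cube_lebesgue: "space (cube_lebesgue :: (real ^ 'n) measure) = unit_cube"
  by (simp add: space_restrict_space)

lemma unit_cube_borel: "(unit_cube :: (real ^ 'n) set) \<in> sets borel"
  unfolding unit_cube_def by measurable

lemma hell_eq_L2_norm:
  fixes t u :: "real ^ 'n \<Rightarrow> real"
  assumes "t \<in> L1_nonneg" "u \<in> L1_nonneg"
  shows "hell t u = L2_norm (\<lambda>x. sqrt (t x) - sqrt (u x)) / sqrt 2"
proof -
  have "sigma_finite_measure (cube_lebesgue :: (real ^ 'n) measure)"
    by (rule sigma_finite_measure_restrict_space)
       (use unit_cube_borel in \<open>auto intro: sigma_finite_lborel\<close>)
  then have "hell t u = sqrt ((1 / 2) * (\<integral>x. (sqrt (t x) - sqrt (u x))\<^sup>2 \<partial>cube_lebesgue))"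
    unfolding hell_def using assms
    by (intro hellinger_density) (auto simp: L1_nonneg_def space_cube_lebesgue)
  then show ?thesis by (simp add: L2_norm_def real_sqrt_mult real_sqrt_divide)
qed


section \<open>T-estimators\<close>

definition D_model :: "'a set \<Rightarrow> ('a \<Rightarrow> 'a \<Rightarrow> real) \<Rightarrow> 'a set \<Rightarrow> real \<Rightarrow> real \<Rightarrow> real \<Rightarrow> bool" where
  "D_model M d S \<eta> D B \<longleftrightarrow>
     S \<subseteq> M \<and> 0 < \<eta> \<and> 0 < D \<and> 0 < B \<and>
     (\<forall>x\<ge>2. \<forall>t\<in>M. finite (S \<inter> {u \<in> M. d t u < x * \<eta>}) \<and>
        real (card (S \<inter> {u \<in> M. d t u < x * \<eta>})) \<le> B * exp (D * x\<^sup>2))"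

text \<open>
  The last condition says that the functions in \<open>\<Union>\<^sub>m S\<^sub>m\<close> are representatives of pairwise
  different elements of \<open>L\<^sub>1\<close>, so that these sets of functions correspond exactly to sets of
  elements of \<open>L\<^sub>1\<close>, with the same cardinalities.
\<close>

definition D_model_family ::
    "'i set \<Rightarrow> ('i \<Rightarrow> (real ^ 'n \<Rightarrow> real) set) \<Rightarrow> ('i \<Rightarrow> real) \<Rightarrow> ('i \<Rightarrow> real) \<Rightarrow> real \<Rightarrow> bool" where
  "D_model_family I S \<eta> D B \<longleftrightarrow>
     countable I \<and>
     (\<forall>m\<in>I. D_model L1_nonneg hell (S m) (\<eta> m) (D m) B \<and> 1 / 2 \<le> D m \<and> 84 * D m / 5 \<le> (\<eta> m)\<^sup>2) \<and>
     (\<lambda>m. exp (- (\<eta> m)\<^sup>2 / 84)) summable_on I \<and>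
     pairwise (\<lambda>t u. \<not> (AE x in cube_lebesgue. t x = u x)) (\<Union>m\<in>I. S m)"

definition model_eta :: "'i set \<Rightarrow> ('i \<Rightarrow> 'a set) \<Rightarrow> ('i \<Rightarrow> real) \<Rightarrow> 'a \<Rightarrow> real" where
  "model_eta I S \<eta> t = Inf {\<eta> m | m. m \<in> I \<and> t \<in> S m}"

text \<open>
  There is one test for each unordered pair of distinct points, hence the symmetry condition;
  its error bounds are required for both orderings of the pair.
\<close>

definition valid_tests ::
    "(real ^ 'n \<Rightarrow> real) set \<Rightarrow> ((real ^ 'n \<Rightarrow> real) \<Rightarrow> real) \<Rightarrow>
     ((real ^ 'n \<Rightarrow> real) \<Rightarrow> (real ^ 'n \<Rightarrow> real) \<Rightarrow> (real ^ 'n) multiset \<Rightarrow> (real ^ 'n \<Rightarrow> real)) \<Rightarrow> bool" where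
  "valid_tests S e \<psi> \<longleftrightarrow>
     (\<forall>t\<in>S. \<forall>u\<in>S. t \<noteq> u \<longrightarrow>
        \<psi> t u \<in> config_space cube_lebesgue \<rightarrow>\<^sub>M count_space {t, u} \<and>
        (\<forall>X\<in>space (config_space cube_lebesgue). \<psi> t u X = \<psi> u t X) \<and>
        (\<forall>\<mu>. finite_measure \<mu> \<and> sets \<mu> = sets cube_lebesgue \<longrightarrow>
           (hellinger \<mu> (intensity_measure t) \<le> hell t u / 4 \<longrightarrow>
              \<P>(X in poisson_process \<mu>. \<psi> t u X = u)
                \<le> exp (- (((hell t u)\<^sup>2 - (e t)\<^sup>2 + (e u)\<^sup>2) / 4))) \<and>
           (hellinger \<mu> (intensity_measure u) \<le> hell t u / 4 \<longrightarrow>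
              \<P>(X in poisson_process \<mu>. \<psi> t u X = t)
                \<le> exp (- (((hell t u)\<^sup>2 - (e u)\<^sup>2 + (e t)\<^sup>2) / 4))) \<and>
           \<P>(X in poisson_process \<mu>. \<psi> t u X = u)
             \<le> exp ((16 * (hellinger \<mu> (intensity_measure t))\<^sup>2 + (e t)\<^sup>2 - (e u)\<^sup>2) / 4)))"

text \<open>The supremum is taken in \<^typ>\<open>ennreal\<close>: it may be infinite, and it is 0 for the empty set.\<close>

definition T_criterion ::
    "(real ^ 'n \<Rightarrow> real) set \<Rightarrow>
     ((real ^ 'n \<Rightarrow> real) \<Rightarrow> (real ^ 'n \<Rightarrow> real) \<Rightarrow> (real ^ 'n) multiset \<Rightarrow> (real ^ 'n \<Rightarrow> real)) \<Rightarrow>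
     (real ^ 'n) multiset \<Rightarrow> (real ^ 'n \<Rightarrow> real) \<Rightarrow> ennreal" where
  "T_criterion S \<psi> X t = (SUP u\<in>{u \<in> S. u \<noteq> t \<and> \<psi> t u X = u}. ennreal (hell t u))"

text \<open>
  The set \<open>S\<close> of candidates is countable, so measurability refers to its discrete sigma-algebra.
  Minimality is only demanded almost surely under each Poisson process, since the criterion need
  not attain its minimum for every single configuration.
\<close>

definition T_estimator ::
    "'i set \<Rightarrow> ('i \<Rightarrow> (real ^ 'n \<Rightarrow> real) set) \<Rightarrow> ('i \<Rightarrow> real) \<Rightarrow>
     ((real ^ 'n) multiset \<Rightarrow> (real ^ 'n \<Rightarrow> real)) \<Rightarrow> bool" where
  "T_estimator I S \<eta> est \<longleftrightarrow>
     (\<exists>\<psi>. valid_tests (\<Union>m\<in>I. S m) (model_eta I S \<eta>) \<psi> \<and>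
        est \<in> config_space cube_lebesgue \<rightarrow>\<^sub>M count_space (\<Union>m\<in>I. S m) \<and>
        (\<forall>\<mu>. finite_measure \<mu> \<and> sets \<mu> = sets cube_lebesgue \<longrightarrow>
           (AE X in poisson_process \<mu>. \<forall>t\<in>(\<Union>m\<in>I. S m).
              T_criterion (\<Union>m\<in>I. S m) \<psi> X (est X) \<le> T_criterion (\<Union>m\<in>I. S m) \<psi> X t)))"

text \<open>
  T-estimators based on linear models \<open>V m\<close> of dimensions \<open>Dbar m\<close> with weights \<open>\<Delta> m\<close>.
  Infima are taken in \<^typ>\<open>ennreal\<close>, where the infimum over an empty set is infinite.
\<close>

definition linear_eta :: "('i \<Rightarrow> nat) \<Rightarrow> ('i \<Rightarrow> real) \<Rightarrow> 'i \<Rightarrow> real" where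
  "linear_eta Dbar \<Delta> m = sqrt (84 * max (\<Delta> m) (9 * real (Dbar m) / 5))"

definition linear_T_estimator ::
    "'i set \<Rightarrow> ('i \<Rightarrow> (real ^ 'n \<Rightarrow> real) set) \<Rightarrow> ('i \<Rightarrow> nat) \<Rightarrow> ('i \<Rightarrow> real) \<Rightarrow>
     ((real ^ 'n) multiset \<Rightarrow> (real ^ 'n \<Rightarrow> real)) \<Rightarrow> bool" where
  "linear_T_estimator I V Dbar \<Delta> est \<longleftrightarrow>
     (\<forall>m\<in>I. V m \<subseteq> L2_space \<and> 0 \<le> \<Delta> m) \<and>
     (\<lambda>m. exp (- \<Delta> m)) summable_on I \<and>
     (\<exists>S. D_model_family I S (linear_eta Dbar \<Delta>) (\<lambda>m. 9 * real (Dbar m)) 1 \<and>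
        (\<forall>m\<in>I. \<forall>t\<in>L1_nonneg.
           (INF u\<in>S m. ennreal (hell t u))
             \<le> ennreal (22 / 10) * ((INF u\<in>V m. ennreal (L2_norm (\<lambda>x. sqrt (t x) - u x)))
                 + ennreal (linear_eta Dbar \<Delta> m))) \<and>
        T_estimator I S (linear_eta Dbar \<Delta>) est)"


section \<open>Piecewise polynomials\<close>

definition grid_cell :: "nat ^ 'n \<Rightarrow> nat ^ 'n \<Rightarrow> (real ^ 'n) set" where
  "grid_cell N i = {x. \<forall>j. real (i $ j) / real (N $ j) \<le> x $ j \<and> x $ j < (real (i $ j) + 1) / real (N $ j)}"

definition piecewise_poly :: "(nat ^ 'n) \<times> nat \<Rightarrow> (real ^ 'n \<Rightarrow> real) set" where
  "piecewise_poly = (\<lambda>(N, r).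
     {u. \<forall>i. (\<forall>j. i $ j < N $ j) \<longrightarrow>
        (\<exists>c. \<forall>x\<in>grid_cell N i.
           u x = (\<Sum>e\<in>{e :: 'n \<Rightarrow> nat. \<forall>j. e j \<le> r}. c e * (\<Prod>j\<in>UNIV. (x $ j) ^ e j)))})"

definition piecewise_poly_dim :: "(nat ^ 'n) \<times> nat \<Rightarrow> nat" where
  "piecewise_poly_dim = (\<lambda>(N, r). (r + 1) ^ CARD('n) * (\<Prod>j\<in>UNIV. N $ j))"

definition grid_models :: "((nat ^ 'n) \<times> nat) set" where
  "grid_models = {(N, r). \<forall>j. 1 \<le> N $ j}"


section \<open>Anisotropic Hoelder classes\<close>

text \<open>
  \<open>g i\<close> is the derivative of order \<open>i\<close> on the half-open interval, one-sided at 0.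
\<close>

definition hoelder :: "real \<Rightarrow> real \<Rightarrow> (real \<Rightarrow> real) set" where
  "hoelder \<alpha> R = {f. 0 < R \<and>
     (\<exists>p \<beta>. \<alpha> = \<beta> + real p \<and> 0 < \<beta> \<and> \<beta> \<le> 1 \<and>
       (\<exists>g. (\<forall>x\<in>{0..<1}. g 0 x = f x) \<and>
          (\<forall>i<p. \<forall>x\<in>{0..<1}. (g i has_real_derivative g (Suc i) x) (at x within {0..<1})) \<and>
          (\<forall>x\<in>{0..<1}. \<forall>y\<in>{0..<1}. \<bar>g p x - g p y\<bar> \<le> R * \<bar>x - y\<bar> powr \<beta>)))}"

definition aniso_hoelder :: "real ^ 'n \<Rightarrow> real ^ 'n \<Rightarrow> (real ^ 'n \<Rightarrow> real) set" where
  "aniso_hoelder \<alpha> R =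
     {f. \<forall>j. \<forall>x\<in>unit_cube. (\<lambda>y. f (\<chi> l. if l = j then y else x $ l)) \<in> hoelder (\<alpha> $ j) (R $ j)}"

definition alpha_bar :: "real ^ 'n \<Rightarrow> real" where
  "alpha_bar \<alpha> = inverse ((\<Sum>j\<in>UNIV. 1 / \<alpha> $ j) / real CARD('n))"

definition R_bar :: "real ^ 'n \<Rightarrow> real ^ 'n \<Rightarrow> real" where
  "R_bar \<alpha> R = (\<Prod>j\<in>UNIV. (R $ j) powr (1 / \<alpha> $ j)) powr (alpha_bar \<alpha> / real CARD('n))"

end

theory Submission
  imports Defs
begin

text \<open>
  The risk of a T-estimator is a squared bias plus a model size. Fix a model \<open>m\<close> and a point
  \<open>t\<close> of \<open>S m\<close>. If the estimator sits at \<open>u\<close> far from \<open>t\<close>, then one of the tests must have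
  preferred to \<open>t\<close> some point that is at least as far from \<open>t\<close>; otherwise the criterion at \<open>t\<close>
  would be smaller than the criterion at \<open>u\<close>, which contradicts minimality
  (\<open>T_estimator_pointwise\<close>). Hence the squared distance from \<open>t\<close> to the estimator is at most
  a threshold of order \<open>H\<^sup>2(s, t) + \<eta>\<^sup>2\<close> plus the sum of \<open>H\<^sup>2(t, u)\<close> over all far \<open>u\<close> that win their
  test against \<open>t\<close>. Taking expectations replaces the winning events by the error bounds of
  the tests, which decay like \<open>exp (- H\<^sup>2(t, u) / 4)\<close> up to the factors involving \<open>\<eta>\<close>. The number of
  points of a D-model at distance less than \<open>y\<close> grows only like \<open>exp (5 y\<^sup>2 / 84)\<close>, so the sum is bounded
  by a constant that depends on the family alone (\<open>family_sum_bound\<close>). This gives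
  \<open>T_estimator_risk\<close>, and \<open>linear_T_estimator_risk\<close> for linear models.
  
  It remains to choose the model. On each cell of the grid the root of the intensity is interpolated
  by tensor products of Lagrange polynomials. In one variable this costs \<open>R N powr - \<alpha>\<close>, because the
  interpolation reproduces the Taylor polynomial and is bounded in the supremum norm. Applying
  the one-dimensional operators one coordinate after the other multiplies the errors by powers of the
  norm only, so the smoothness of the one-dimensional slices is enough (\<open>aniso_hoelder_approximation\<close>).
  Finally \<open>N\<^sub>j\<close> is chosen so that every coordinate contributes a bias of the same
  order \<open>\<theta> = R_bar powr (k / (2 * alpha_bar + k))\<close>; the number of cells is then of order \<open>\<theta>\<^sup>2\<close> as well
  (\<open>balanced_grid\<close>). The assumption \<open>R\<^sub>j \<ge> \<theta>\<close> says that this choice asks for at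
  least one cell in each direction, so that rounding \<open>N\<^sub>j\<close> up costs a factor 2 only.
\<close>

section \<open>Hellinger distance between intensities\<close>

lemma integrable_sqrt_diff_sq:
  fixes t u :: "real ^ 'n \<Rightarrow> real"
  assumes "t \<in> L1_nonneg" "u \<in> L1_nonneg"
  shows "integrable cube_lebesgue (\<lambda>x. (sqrt (t x) - sqrt (u x))\<^sup>2)"
proof (rule Bochner_Integration.integrable_bound[where f="\<lambda>x. t x + u x"])
  have [measurable]: "t \<in> borel_measurable cube_lebesgue" "u \<in> borel_measurable cube_lebesgue"
    using assms by (auto simp: L1_nonneg_def)
  show "(\<lambda>x. (sqrt (t x) - sqrt (u x))\<^sup>2) \<in> borel_measurable cube_lebesgue"
    by measurable
  show "integrable cube_lebesgue (\<lambda>x. t x + u x)"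
    using assms by (auto simp: L1_nonneg_def)
  show "AE x in cube_lebesgue. norm ((sqrt (t x) - sqrt (u x))\<^sup>2) \<le> norm (t x + u x)"
  proof (rule AE_I2)
    fix x :: "real ^ 'n" assume "x \<in> space cube_lebesgue"
    then have "0 \<le> t x" "0 \<le> u x"
      using assms by (auto simp: L1_nonneg_def space_cube_lebesgue)
    then have "(sqrt (t x) - sqrt (u x))\<^sup>2 \<le> t x + u x"
      by (simp add: power2_diff)
    then show "norm ((sqrt (t x) - sqrt (u x))\<^sup>2) \<le> norm (t x + u x)"
      by simp
  qed
qed

lemma hell_sq:
  assumes "t \<in> L1_nonneg" "u \<in> L1_nonneg"
  shows "(hell t u)\<^sup>2 = (\<integral>x. (sqrt (t x) - sqrt (u x))\<^sup>2 \<partial>cube_lebesgue) / 2"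
  by (simp add: hell_eq_L2_norm[OF assms] L2_norm_def power_divide)

lemma hell_nonneg: "t \<in> L1_nonneg \<Longrightarrow> u \<in> L1_nonneg \<Longrightarrow> 0 \<le> hell t u"
  by (simp add: hell_eq_L2_norm L2_norm_def)

lemma hell_self: "t \<in> L1_nonneg \<Longrightarrow> hell t t = 0"
  by (simp add: hell_eq_L2_norm L2_norm_def)

lemma hell_commute: "t \<in> L1_nonneg \<Longrightarrow> u \<in> L1_nonneg \<Longrightarrow> hell t u = hell u t"
  by (simp add: hell_eq_L2_norm L2_norm_def power2_commute)

text \<open>This form of the triangle inequality is enough for a risk bound that ignores constants.\<close>

lemma hell_sq_triangle:
  assumes s: "s \<in> L1_nonneg" and t: "t \<in> L1_nonneg" and u: "u \<in> L1_nonneg"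
  shows "(hell s u)\<^sup>2 \<le> 2 * (hell s t)\<^sup>2 + 2 * (hell t u)\<^sup>2"
proof -
  note int = integrable_sqrt_diff_sq[OF s t] integrable_sqrt_diff_sq[OF t u]
  have "(\<integral>x. (sqrt (s x) - sqrt (u x))\<^sup>2 \<partial>cube_lebesgue)
      \<le> (\<integral>x. 2 * (sqrt (s x) - sqrt (t x))\<^sup>2 + 2 * (sqrt (t x) - sqrt (u x))\<^sup>2 \<partial>cube_lebesgue)"
  proof (rule integral_mono)
    fix x
    have "(a + b)\<^sup>2 \<le> 2 * a\<^sup>2 + 2 * b\<^sup>2" for a b :: real
      using sum_squares_bound[of a b] by (simp add: power2_sum)
    from this[of "sqrt (s x) - sqrt (t x)" "sqrt (t x) - sqrt (u x)"]
    show "(sqrt (s x) - sqrt (u x))\<^sup>2 \<le> 2 * (sqrt (s x) - sqrt (t x))\<^sup>2 + 2 * (sqrt (t x) - sqrt (u x))\<^sup>2"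
      by simp
  qed (use int integrable_sqrt_diff_sq[OF s u] in auto)
  also have "\<dots> = 2 * (\<integral>x. (sqrt (s x) - sqrt (t x))\<^sup>2 \<partial>cube_lebesgue)
      + 2 * (\<integral>x. (sqrt (t x) - sqrt (u x))\<^sup>2 \<partial>cube_lebesgue)"
    using int by simp
  finally show ?thesis by (simp add: hell_sq s t u)
qed

lemma finite_measure_intensity:
  assumes "s \<in> L1_nonneg"
  shows "finite_measure (intensity_measure s)"
proof (rule finite_measureI)
  have int: "integrable cube_lebesgue s" and "\<forall>x\<in>unit_cube. 0 \<le> s x"
    using assms by (auto simp: L1_nonneg_def)
  then have "(\<integral>\<^sup>+x. ennreal (s x) \<partial>cube_lebesgue) = ennreal (\<integral>x. s x \<partial>cube_lebesgue)"
    by (intro nn_integral_eq_integral AE_I2) (auto simp: space_cube_lebesgue)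
  then show "emeasure (intensity_measure s) (space (intensity_measure s)) \<noteq> \<infinity>"
    using int by (simp add: emeasure_density cong: nn_integral_cong)
qed

section \<open>Sums over D-models\<close>

text \<open>This is the value of the series \<open>\<Sum>n. (n + 1) * exp (- (n / 6)) * exp (5 * (n + 1) / 84)\<close>, which
  arises when a D-model is cut into the shells \<open>n \<le> d\<^sup>2 < n + 1\<close>.\<close>

definition shell_const :: real where
  "shell_const = exp (5 / 84) / (1 - exp (- (9 / 84)))\<^sup>2"

text \<open>
  The definition of a D-model controls balls of radius at least \<open>2 * \<eta>\<close>. Smaller balls lie in
  the one of radius \<open>2 * \<eta>\<close>, which accounts for the summand \<open>5 * \<eta>\<^sup>2 / 21 = (5 * \<eta>\<^sup>2 / 84) * 4\<close>.
\<close>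

lemma D_model_card:
  assumes "D_model M d S \<eta> D 1" "84 * D / 5 \<le> \<eta>\<^sup>2" "t \<in> M" "0 \<le> y"
  shows "finite {u\<in>S. d t u < y}"
    and "real (card {u\<in>S. d t u < y}) \<le> exp (5 * y\<^sup>2 / 84 + 5 * \<eta>\<^sup>2 / 21)"
proof -
  have SM: "S \<subseteq> M" and eta: "0 < \<eta>" and D: "0 < D"
    using assms(1) by (auto simp: D_model_def)
  define x where "x = max 2 (y / \<eta>)"
  have x2: "2 \<le> x" by (simp add: x_def)
  have yx: "y \<le> x * \<eta>" using eta by (simp add: x_def field_simps max_def)
  have sub: "{u\<in>S. d t u < y} \<subseteq> S \<inter> {u \<in> M. d t u < x * \<eta>}"
    using SM yx by auto
  have fin: "finite (S \<inter> {u \<in> M. d t u < x * \<eta>})"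
    and card: "real (card (S \<inter> {u \<in> M. d t u < x * \<eta>})) \<le> exp (D * x\<^sup>2)"
    using assms(1,3) x2 by (auto simp: D_model_def)
  show "finite {u\<in>S. d t u < y}" using fin sub by (rule finite_subset[rotated])
  have x_sq: "x\<^sup>2 \<le> 4 + (y / \<eta>)\<^sup>2"
    by (cases "y / \<eta> \<le> 2") (auto simp: x_def max_def)
  have "D * x\<^sup>2 \<le> (5 * \<eta>\<^sup>2 / 84) * (4 + (y / \<eta>)\<^sup>2)"
    by (rule mult_mono) (use x_sq assms(2) D in auto)
  also have "\<dots> = 5 * y\<^sup>2 / 84 + 5 * \<eta>\<^sup>2 / 21"
    using eta by (simp add: field_simps)
  finally have "D * x\<^sup>2 \<le> 5 * y\<^sup>2 / 84 + 5 * \<eta>\<^sup>2 / 21" .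
  moreover have "card {u\<in>S. d t u < y} \<le> card (S \<inter> {u \<in> M. d t u < x * \<eta>})"
    by (rule card_mono[OF fin sub])
  ultimately show "real (card {u\<in>S. d t u < y}) \<le> exp (5 * y\<^sup>2 / 84 + 5 * \<eta>\<^sup>2 / 21)"
    using card by (smt (verit) exp_le_cancel_iff of_nat_le_iff)
qed

lemma D_model_countable:
  assumes "D_model M d S \<eta> D B" "t \<in> M"
  shows "countable S"
proof -
  have sub: "S \<subseteq> (\<Union>n::nat. S \<inter> {u \<in> M. d t u < (2 + real n) * \<eta>})"
  proof
    fix u assume u: "u \<in> S"
    obtain n :: nat where "d t u / \<eta> < real n" using reals_Archimedean2 by blast
    then have "d t u < (2 + real n) * \<eta>"
      using assms(1) by (simp add: D_model_def field_simps)
    then show "u \<in> (\<Union>n::nat. S \<inter> {u \<in> M. d t u < (2 + real n) * \<eta>})"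
      using u assms(1) by (auto simp: D_model_def)
  qed
  have "countable (S \<inter> {u \<in> M. d t u < (2 + real n) * \<eta>})" for n :: nat
    using assms by (intro countable_finite) (simp add: D_model_def)
  then have "countable (\<Union>n::nat. S \<inter> {u \<in> M. d t u < (2 + real n) * \<eta>})"
    by (intro countable_UN) auto
  then show ?thesis using sub by (rule countable_subset[rotated])
qed

text \<open>
  On the shell \<open>n \<le> d\<^sup>2 < n + 1\<close> the summand is at most \<open>(n + 1) * exp (- (n / 6))\<close>, and
  the number of points of \<open>S\<close> there grows like \<open>exp (5 * n / 84)\<close>. Since \<open>1 / 6 > 5 / 84\<close>, the sum over
  the shells converges, uniformly in the centre \<open>t\<close>.
\<close>

lemma D_model_sum_bound:
  assumes "D_model M d S \<eta> D 1" "84 * D / 5 \<le> \<eta>\<^sup>2" "t \<in> M"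
    and nonneg: "\<And>u. u \<in> M \<Longrightarrow> 0 \<le> d t u"
  shows "(\<integral>\<^sup>+u. ennreal ((d t u)\<^sup>2 * exp (- ((d t u)\<^sup>2 / 6))) \<partial>count_space S)
    \<le> ennreal (shell_const * exp (5 * \<eta>\<^sup>2 / 21))"
proof -
  define w :: "nat \<Rightarrow> real" where "w n = (real n + 1) * exp (- (real n / 6))" for n
  let ?B = "\<lambda>n::nat. {u\<in>S. d t u < sqrt (real n + 1)}"
  have w0: "0 \<le> w n" for n by (simp add: w_def)
  have SM: "S \<subseteq> M" using assms(1) by (simp add: D_model_def)
  have "(\<integral>\<^sup>+u. ennreal ((d t u)\<^sup>2 * exp (- ((d t u)\<^sup>2 / 6))) \<partial>count_space S)
     \<le> (\<integral>\<^sup>+u. (\<integral>\<^sup>+n. ennreal (w n) * indicator (?B n) u \<partial>count_space UNIV) \<partial>count_space S)"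
  proof (rule nn_integral_mono)
    fix u assume "u \<in> space (count_space S)"
    then have u: "u \<in> S" by simp
    then have d0: "0 \<le> d t u" using SM nonneg by blast
    define n where "n = nat \<lfloor>(d t u)\<^sup>2\<rfloor>"
    have n: "real n \<le> (d t u)\<^sup>2" "(d t u)\<^sup>2 < real n + 1"
      unfolding n_def using of_nat_floor floor_correct[of "(d t u)\<^sup>2"] by auto
    have "(d t u)\<^sup>2 * exp (- ((d t u)\<^sup>2 / 6)) \<le> w n"
      unfolding w_def by (rule mult_mono) (use n in auto)
    moreover have "d t u < sqrt (real n + 1)"
      using n(2) d0 by (simp add: real_less_rsqrt)
    ultimately have "ennreal ((d t u)\<^sup>2 * exp (- ((d t u)\<^sup>2 / 6))) \<le> ennreal (w n) * indicator (?B n) u"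
      using u by (simp add: ennreal_leI)
    also have "\<dots> \<le> (\<integral>\<^sup>+n. ennreal (w n) * indicator (?B n) u \<partial>count_space UNIV)"
      by (rule nn_integral_ge_point[where p="\<lambda>n. ennreal (w n) * indicator (?B n) u"]) simp
    finally show "ennreal ((d t u)\<^sup>2 * exp (- ((d t u)\<^sup>2 / 6)))
      \<le> (\<integral>\<^sup>+n. ennreal (w n) * indicator (?B n) u \<partial>count_space UNIV)" .
  qed
  also have "\<dots> = (\<integral>\<^sup>+n. (\<integral>\<^sup>+u. ennreal (w n) * indicator (?B n) u \<partial>count_space S) \<partial>count_space UNIV)"
    by (rule nn_integral_count_space_nn_integral) auto
  also have "\<dots> \<le> (\<integral>\<^sup>+n. ennreal (exp (5 / 84) * exp (5 * \<eta>\<^sup>2 / 21) * (real (Suc n) * exp (- (9 / 84)) ^ n)) \<partial>count_space UNIV)"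
  proof (rule nn_integral_mono)
    fix n :: nat
    have B: "finite (?B n)" "real (card (?B n)) \<le> exp (5 * (real n + 1) / 84 + 5 * \<eta>\<^sup>2 / 21)"
      using D_model_card[OF assms(1,2,3), of "sqrt (real n + 1)"] by auto
    have "(\<integral>\<^sup>+u. ennreal (w n) * indicator (?B n) u \<partial>count_space S) = ennreal (w n) * emeasure (count_space S) (?B n)"
      by (rule nn_integral_cmult_indicator) auto
    also have "\<dots> = ennreal (w n) * ennreal (card (?B n))"
      using B by (subst emeasure_count_space_finite) (auto simp: ennreal_of_nat_eq_real_of_nat)
    also have "\<dots> = ennreal (w n * card (?B n))"
      using w0 by (simp add: ennreal_mult)
    also have "w n * card (?B n) \<le> w n * exp (5 * (real n + 1) / 84 + 5 * \<eta>\<^sup>2 / 21)"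
      using B(2) w0 by (rule mult_left_mono)
    also have "\<dots> = exp (5 / 84) * exp (5 * \<eta>\<^sup>2 / 21) * (real (Suc n) * exp (- (9 / 84)) ^ n)"
    proof -
      have "exp (- (real n / 6)) * exp (5 * (real n + 1) / 84 + 5 * \<eta>\<^sup>2 / 21)
        = exp (5 / 84) * exp (5 * \<eta>\<^sup>2 / 21) * exp (real n * (- (9 / 84)))"
        unfolding exp_add[symmetric] by (simp add: field_simps)
      then show ?thesis
        unfolding w_def exp_of_nat_mult by (simp add: algebra_simps)
    qed
    finally show "(\<integral>\<^sup>+u. ennreal (w n) * indicator (?B n) u \<partial>count_space S)
      \<le> ennreal (exp (5 / 84) * exp (5 * \<eta>\<^sup>2 / 21) * (real (Suc n) * exp (- (9 / 84)) ^ n))"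
      by (simp add: ennreal_leI)
  qed
  also have "\<dots> = ennreal (shell_const * exp (5 * \<eta>\<^sup>2 / 21))"
  proof -
    have "(\<lambda>n. of_nat (Suc n) * exp (- (9 / 84) :: real) ^ n) sums (1 / (1 - exp (- (9 / 84)))\<^sup>2)"
      by (rule geometric_deriv_sums) simp
    from sums_mult[OF this, of "exp (5 / 84) * exp (5 * \<eta>\<^sup>2 / 21)"]
    show ?thesis
      unfolding nn_integral_count_space_nat
      by (subst suminf_ennreal_eq) (auto simp: shell_const_def mult_ac)
  qed
  finally show ?thesis .
qed

lemma model_eta_le:
  assumes "\<And>m. m \<in> I \<Longrightarrow> 0 \<le> \<eta> m" "m \<in> I" "t \<in> S m"
  shows "0 \<le> model_eta I S \<eta> t" "model_eta I S \<eta> t \<le> \<eta> m"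
  unfolding model_eta_def using assms
  by (auto intro!: cInf_greatest cInf_lower bdd_belowI[where m=0])

text \<open>The infimum is approached up to a slack in the square, which later costs a constant factor.\<close>

lemma model_eta_approx:
  assumes "\<And>m. m \<in> I \<Longrightarrow> 0 \<le> \<eta> m" "u \<in> (\<Union>m\<in>I. S m)" "0 < \<epsilon>"
  obtains m where "m \<in> I" "u \<in> S m" "(\<eta> m)\<^sup>2 \<le> (model_eta I S \<eta> u)\<^sup>2 + \<epsilon>"
proof -
  obtain m0 where m0: "m0 \<in> I" "u \<in> S m0" using assms(2) by auto
  have 0: "0 \<le> model_eta I S \<eta> u"
    using model_eta_le(1)[of I \<eta> m0 u S] assms(1) m0 by auto
  then have "model_eta I S \<eta> u < sqrt ((model_eta I S \<eta> u)\<^sup>2 + \<epsilon>)"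
    using assms(3) by (intro real_less_rsqrt) simp
  then have "\<exists>x\<in>{\<eta> m | m. m \<in> I \<and> u \<in> S m}. x < sqrt ((model_eta I S \<eta> u)\<^sup>2 + \<epsilon>)"
    using m0 unfolding model_eta_def[of I S \<eta> u] by (intro cInf_lessD) auto
  then obtain m where m: "m \<in> I" "u \<in> S m" "\<eta> m < sqrt ((model_eta I S \<eta> u)\<^sup>2 + \<epsilon>)"
    by auto
  moreover have "(\<eta> m)\<^sup>2 \<le> (model_eta I S \<eta> u)\<^sup>2 + \<epsilon>"
    using power_mono[of "\<eta> m" "sqrt ((model_eta I S \<eta> u)\<^sup>2 + \<epsilon>)" 2] m assms(1)[OF m(1)] assms(3)
    by simp
  ultimately show thesis using that by blast
qed

text \<open>
  Each point is charged to a model in which it almost attains \<open>model_eta\<close>. Within that model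
  \<open>exp (5 * \<eta>\<^sup>2 / 21)\<close> is lost by counting points and \<open>exp (- (\<eta>\<^sup>2 / 4))\<close> is gained from the weights. Their product
  is \<open>exp (- (\<eta>\<^sup>2 / 84))\<close>, exactly the term of the series that the family makes convergent.
\<close>

lemma family_sum_bound:
  fixes \<eta> :: "'i \<Rightarrow> real" and S :: "'i \<Rightarrow> (real ^ 'n \<Rightarrow> real) set"
  assumes fam: "D_model_family I S \<eta> D 1" and t: "t \<in> L1_nonneg"
  shows "(\<integral>\<^sup>+u. ennreal ((hell t u)\<^sup>2 * exp (- ((hell t u)\<^sup>2 / 6)) * exp (- ((model_eta I S \<eta> u)\<^sup>2 / 4)))
      \<partial>count_space (\<Union>m\<in>I. S m))
    \<le> ennreal (exp 1 * shell_const * (\<Sum>\<^sub>\<infinity>m\<in>I. exp (- ((\<eta> m)\<^sup>2) / 84)))"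
proof -
  have I: "countable I" and summ: "(\<lambda>m. exp (- (\<eta> m)\<^sup>2 / 84)) summable_on I"
    and model: "\<And>m. m \<in> I \<Longrightarrow> D_model L1_nonneg hell (S m) (\<eta> m) (D m) 1"
    and D: "\<And>m. m \<in> I \<Longrightarrow> 84 * D m / 5 \<le> (\<eta> m)\<^sup>2"
    using fam by (auto simp: D_model_family_def)
  have eta: "0 \<le> \<eta> m" if "m \<in> I" for m
    using model[OF that] by (simp add: D_model_def)
  define g where "g u = (hell t u)\<^sup>2 * exp (- ((hell t u)\<^sup>2 / 6))" for u
  have g0: "0 \<le> g u" for u by (simp add: g_def)
  let ?U = "\<Union>m\<in>I. S m"
  have "(\<integral>\<^sup>+u. ennreal (g u * exp (- ((model_eta I S \<eta> u)\<^sup>2 / 4))) \<partial>count_space ?U)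
    \<le> (\<integral>\<^sup>+u. (\<integral>\<^sup>+m. ennreal (exp 1 * exp (- ((\<eta> m)\<^sup>2 / 4))) * (ennreal (g u) * indicator (S m) u) \<partial>count_space I) \<partial>count_space ?U)"
  proof (rule nn_integral_mono)
    fix u assume "u \<in> space (count_space ?U)"
    then have "u \<in> ?U" by simp
    \<comment> \<open>The slack 4 is divided by 4 in the exponent and becomes the factor \<open>exp 1\<close>.\<close>
    then obtain m where m: "m \<in> I" "u \<in> S m" "(\<eta> m)\<^sup>2 \<le> (model_eta I S \<eta> u)\<^sup>2 + 4"
      using model_eta_approx[of I \<eta> u S 4] eta by auto
    have "exp (- ((model_eta I S \<eta> u)\<^sup>2 / 4)) \<le> exp (1 - ((\<eta> m)\<^sup>2 / 4))"
      using m(3) by simp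
    then have "g u * exp (- ((model_eta I S \<eta> u)\<^sup>2 / 4)) \<le> exp 1 * exp (- ((\<eta> m)\<^sup>2 / 4)) * g u"
      using g0[of u] by (subst (asm) diff_conv_add_uminus, subst (asm) exp_add)
         (simp add: mult.commute mult_left_mono)
    then have "ennreal (g u * exp (- ((model_eta I S \<eta> u)\<^sup>2 / 4)))
      \<le> ennreal (exp 1 * exp (- ((\<eta> m)\<^sup>2 / 4))) * (ennreal (g u) * indicator (S m) u)"
      using m(2) g0[of u] by (simp add: ennreal_mult[symmetric] ennreal_leI)
    also have "\<dots> \<le> (\<integral>\<^sup>+m. ennreal (exp 1 * exp (- ((\<eta> m)\<^sup>2 / 4))) * (ennreal (g u) * indicator (S m) u) \<partial>count_space I)"
      using m(1) by (rule nn_integral_ge_point)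
    finally show "ennreal (g u * exp (- ((model_eta I S \<eta> u)\<^sup>2 / 4))) \<le> \<dots>" .
  qed
  also have "\<dots> = (\<integral>\<^sup>+m. (\<integral>\<^sup>+u. ennreal (exp 1 * exp (- ((\<eta> m)\<^sup>2 / 4))) * (ennreal (g u) * indicator (S m) u) \<partial>count_space ?U) \<partial>count_space I)"
    by (rule nn_integral_count_space_nn_integral[OF I]) auto
  also have "\<dots> \<le> (\<integral>\<^sup>+m. ennreal (exp 1 * shell_const) * ennreal (exp (- (\<eta> m)\<^sup>2 / 84)) \<partial>count_space I)"
  proof (rule nn_integral_mono)
    fix m assume "m \<in> space (count_space I)"
    then have m: "m \<in> I" by simp
    have "(\<integral>\<^sup>+u. ennreal (g u) * indicator (S m) u \<partial>count_space ?U) = (\<integral>\<^sup>+u. ennreal (g u) \<partial>count_space (S m))"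
      using m by (subst nn_integral_count_space_indicator[of "S m"])
         (auto simp: nn_integral_count_space_indicator intro!: nn_integral_cong split: split_indicator)
    also have "\<dots> \<le> ennreal (shell_const * exp (5 * (\<eta> m)\<^sup>2 / 21))"
      unfolding g_def using model[OF m] D[OF m] t
      by (rule D_model_sum_bound) (simp add: hell_nonneg t)
    finally have "(\<integral>\<^sup>+u. ennreal (exp 1 * exp (- ((\<eta> m)\<^sup>2 / 4))) * (ennreal (g u) * indicator (S m) u) \<partial>count_space ?U)
      \<le> ennreal (exp 1 * exp (- ((\<eta> m)\<^sup>2 / 4))) * ennreal (shell_const * exp (5 * (\<eta> m)\<^sup>2 / 21))"
      by (subst nn_integral_cmult) (auto intro!: mult_left_mono)
    also have "\<dots> = ennreal (exp 1 * exp (- ((\<eta> m)\<^sup>2 / 4)) * (shell_const * exp (5 * (\<eta> m)\<^sup>2 / 21)))"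
      by (simp add: ennreal_mult[symmetric] shell_const_def)
    also have "exp 1 * exp (- ((\<eta> m)\<^sup>2 / 4)) * (shell_const * exp (5 * (\<eta> m)\<^sup>2 / 21))
      = exp 1 * shell_const * exp (- (\<eta> m)\<^sup>2 / 84)"
    proof -
      have "exp (- ((\<eta> m)\<^sup>2 / 4)) * exp (5 * (\<eta> m)\<^sup>2 / 21) = exp (- (\<eta> m)\<^sup>2 / 84)"
        unfolding exp_add[symmetric] by (simp add: field_simps)
      then show ?thesis by (simp add: mult_ac)
    qed
    also have "ennreal (exp 1 * shell_const * exp (- (\<eta> m)\<^sup>2 / 84))
      = ennreal (exp 1 * shell_const) * ennreal (exp (- (\<eta> m)\<^sup>2 / 84))"
      by (simp add: ennreal_mult[symmetric] shell_const_def)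
    finally show "(\<integral>\<^sup>+u. ennreal (exp 1 * exp (- ((\<eta> m)\<^sup>2 / 4))) * (ennreal (g u) * indicator (S m) u) \<partial>count_space ?U)
       \<le> ennreal (exp 1 * shell_const) * ennreal (exp (- (\<eta> m)\<^sup>2 / 84))" .
  qed
  also have "\<dots> = ennreal (exp 1 * shell_const) * (\<integral>\<^sup>+m. ennreal (exp (- (\<eta> m)\<^sup>2 / 84)) \<partial>count_space I)"
    by (rule nn_integral_cmult) simp
  also have "(\<integral>\<^sup>+m. ennreal (exp (- (\<eta> m)\<^sup>2 / 84)) \<partial>count_space I) = ennreal (\<Sum>\<^sub>\<infinity>m\<in>I. exp (- (\<eta> m)\<^sup>2 / 84))"
  proof -
    have "(\<lambda>m. norm (exp (- (\<eta> m)\<^sup>2 / 84))) summable_on I"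
      using summ by simp
    then have abs: "Infinite_Set_Sum.abs_summable_on (\<lambda>m. exp (- (\<eta> m)\<^sup>2 / 84)) I"
      by (subst abs_summable_equivalent[symmetric])
    then show ?thesis
      by (subst nn_integral_conv_infsetsum) (auto simp: infsetsum_infsum)
  qed
  finally show ?thesis
    by (simp add: g_def ennreal_mult[symmetric] infsum_nonneg shell_const_def)
qed

section \<open>Risk of T-estimators\<close>

definition risk_const :: "'i set \<Rightarrow> ('i \<Rightarrow> real) \<Rightarrow> real" where
  "risk_const I \<eta> = exp 1 * shell_const * (\<Sum>\<^sub>\<infinity>m\<in>I. exp (- ((\<eta> m)\<^sup>2) / 84))"

lemma risk_const_nonneg: "0 \<le> risk_const I \<eta>"
  by (simp add: risk_const_def shell_const_def infsum_nonneg)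

text \<open>
  If \<open>t\<close> beats \<open>v\<close>, then \<open>hell t v\<close> is one of the distances in the criterion at \<open>v\<close>, hence at
  most the criterion at \<open>t\<close>, which \<open>b\<close> dominates. If \<open>v\<close> beats \<open>t\<close>, then \<open>v\<close> itself is among the
  points to which the bound applies.
\<close>

lemma T_estimator_pointwise:
  fixes S :: "'i \<Rightarrow> (real ^ 'n \<Rightarrow> real) set" and I :: "'i set"
  defines "U \<equiv> (\<Union>m\<in>I. S m)"
  assumes U: "U \<subseteq> L1_nonneg"
    and tests: "valid_tests U e \<psi>"
    and X: "X \<in> space (config_space cube_lebesgue)"
    and t: "t \<in> U" and v: "v \<in> U"
    and min: "T_criterion U \<psi> X v \<le> T_criterion U \<psi> X t"
    and bound: "\<And>u. u \<in> U \<Longrightarrow> u \<noteq> t \<Longrightarrow> \<psi> t u X = u \<Longrightarrow> hell t u \<le> b"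
    and b: "0 \<le> b"
  shows "hell t v \<le> b"
proof -
  have tL: "t \<in> L1_nonneg" and vL: "v \<in> L1_nonneg" using U t v by auto
  consider "v = t" | "v \<noteq> t" "\<psi> t v X = v" | "v \<noteq> t" "\<psi> t v X \<noteq> v" by blast
  then show ?thesis
  proof cases
    case 1
    then show ?thesis using hell_self[OF tL] b by simp
  next
    case 2
    then show ?thesis by (rule bound[OF v])
  next
    case 3
    have "\<psi> t v \<in> config_space cube_lebesgue \<rightarrow>\<^sub>M count_space {t, v}" "\<psi> t v X = \<psi> v t X"
      using tests[unfolded valid_tests_def, rule_format, OF t v 3(1)[symmetric]] X by blast+
    then have "\<psi> v t X = t"
      using measurable_space[of "\<psi> t v", OF _ X] 3(2) by fastforce
    then have "ennreal (hell v t) \<le> T_criterion U \<psi> X v"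
      unfolding T_criterion_def using t 3(1) by (intro SUP_upper) simp
    also have "\<dots> \<le> T_criterion U \<psi> X t" by (fact min)
    also have "\<dots> \<le> ennreal b"
      unfolding T_criterion_def
    proof (rule SUP_least)
      fix u assume "u \<in> {u \<in> U. u \<noteq> t \<and> \<psi> t u X = u}"
      then show "ennreal (hell t u) \<le> ennreal b" by (intro ennreal_leI bound) auto
    qed
    finally show ?thesis
      using b unfolding hell_commute[OF tL vL] by simp
  qed
qed

text \<open>
  The threshold \<open>y\<close> that separates near from far points serves two purposes: its part
  \<open>16 * (hell s t)\<^sup>2\<close> puts the true intensity close enough to \<open>t\<close> for the error bound of the test between
  \<open>t\<close> and a far point, and its part \<open>3 * (\<eta> m)\<^sup>2\<close> lets a third of the exponent \<open>(hell t u)\<^sup>2 / 4\<close>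
  absorb the factor \<open>exp ((e t)\<^sup>2 / 4)\<close> in that bound, leaving \<open>exp (- ((hell t u)\<^sup>2 / 6))\<close>.
\<close>

theorem T_estimator_risk:
  fixes s :: "real ^ 'n \<Rightarrow> real"
  assumes fam: "D_model_family I S \<eta> D 1" and est: "T_estimator I S \<eta> est"
    and s: "s \<in> L1_nonneg" and m: "m \<in> I" "t \<in> S m"
  shows "(\<integral>\<^sup>+ X. ennreal ((hell s (est X))\<^sup>2) \<partial>poisson_process (intensity_measure s))
    \<le> ennreal (34 * (hell s t)\<^sup>2 + 6 * (\<eta> m)\<^sup>2 + 2 * risk_const I \<eta>)"
proof -
  define U where "U = (\<Union>m\<in>I. S m)"
  define e where "e = model_eta I S \<eta>"
  let ?P = "poisson_process (intensity_measure s)"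
  have model: "D_model L1_nonneg hell (S m) (\<eta> m) (D m) 1" if "m \<in> I" for m
    using fam that by (auto simp: D_model_family_def)
  have I: "countable I" using fam by (simp add: D_model_family_def)
  have eta: "0 \<le> \<eta> m" if "m \<in> I" for m
    using model[OF that] by (simp add: D_model_def)
  have UL: "U \<subseteq> L1_nonneg"
    using model by (auto simp: U_def D_model_def)
  have tU: "t \<in> U" using m by (auto simp: U_def)
  then have t: "t \<in> L1_nonneg" using UL by auto
  have U: "countable U"
    unfolding U_def using D_model_countable[OF model t] by (intro countable_UN I)
  obtain \<psi> where tests: "valid_tests U e \<psi>"
    and meas: "est \<in> config_space cube_lebesgue \<rightarrow>\<^sub>M count_space U"
    and min: "\<And>\<mu>. finite_measure \<mu> \<Longrightarrow> sets \<mu> = sets cube_lebesgue \<Longrightarrow>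
       AE X in poisson_process \<mu>. \<forall>t\<in>U. T_criterion U \<psi> X (est X) \<le> T_criterion U \<psi> X t"
    using est unfolding T_estimator_def U_def e_def by blast
  have finm: "finite_measure (intensity_measure s)" by (rule finite_measure_intensity[OF s])
  interpret prob_space ?P by (rule prob_space_poisson_process[OF finm])
  have config: "config_space (intensity_measure s) = config_space cube_lebesgue"
    by (simp add: config_space_def)
  have space: "space ?P = space (config_space cube_lebesgue)"
    by (rule sets_eq_imp_space_eq) (simp add: config)
  have sets: "sets ?P = sets (config_space cube_lebesgue)" by (simp add: config)

  define y where "y = 16 * (hell s t)\<^sup>2 + 3 * (\<eta> m)\<^sup>2"
  have y0: "0 \<le> y" by (simp add: y_def)
  define E where "E u = {X \<in> space ?P. \<psi> t u X = u}" for u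
  define far where "far = {u \<in> U. u \<noteq> t \<and> y < (hell t u)\<^sup>2}"
  have far: "countable far" using U by (auto simp: far_def intro: countable_subset)
  have E: "E u \<in> events" if "u \<in> far" for u
  proof -
    have "\<psi> t u \<in> config_space cube_lebesgue \<rightarrow>\<^sub>M count_space {t, u}"
      using tests tU that by (auto simp: valid_tests_def far_def)
    then have "\<psi> t u \<in> ?P \<rightarrow>\<^sub>M count_space {t, u}"
      by (simp only: measurable_cong_sets[OF sets refl])
    then have "\<psi> t u -` {u} \<inter> space ?P \<in> events"
      by (rule measurable_sets) simp
    moreover have "\<psi> t u -` {u} \<inter> space ?P = E u" by (auto simp: E_def)
    ultimately show ?thesis by simp
  qed
  define Z where "Z X = (\<integral>\<^sup>+u. ennreal ((hell t u)\<^sup>2) * indicator (E u) X \<partial>count_space far)" for X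
  have Z_meas: "Z \<in> borel_measurable ?P"
    unfolding Z_def
  proof (rule sigma_finite_measure.borel_measurable_nn_integral)
    show "sigma_finite_measure (count_space far)"
      using far by (rule sigma_finite_measure_count_space_countable)
    show "(\<lambda>(X, u). ennreal ((hell t u)\<^sup>2) * indicator (E u) X)
        \<in> borel_measurable (?P \<Otimes>\<^sub>M count_space far)"
      unfolding case_prod_beta
    proof (rule measurable_compose_countable'[where g=snd and I=far])
      fix u assume "u \<in> far"
      note [measurable] = E[OF this]
      show "(\<lambda>p. ennreal ((hell t u)\<^sup>2) * indicator (E u) (fst p))
          \<in> borel_measurable (?P \<Otimes>\<^sub>M count_space far)"
        by measurable
    qed (use far in auto)
  qed

  have EZ: "(\<integral>\<^sup>+X. Z X \<partial>?P) \<le> ennreal (risk_const I \<eta>)"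
  proof -
    have "(\<integral>\<^sup>+X. Z X \<partial>?P) = (\<integral>\<^sup>+u. (\<integral>\<^sup>+X. ennreal ((hell t u)\<^sup>2) * indicator (E u) X \<partial>?P) \<partial>count_space far)"
      unfolding Z_def
    proof (rule nn_integral_count_space_nn_integral[OF far])
      fix u assume "u \<in> far"
      note [measurable] = E[OF this]
      show "(\<lambda>X. ennreal ((hell t u)\<^sup>2) * indicator (E u) X) \<in> borel_measurable ?P"
        by measurable
    qed
    also have "\<dots> \<le> (\<integral>\<^sup>+u. ennreal ((hell t u)\<^sup>2 * exp (- ((hell t u)\<^sup>2 / 6)) * exp (- ((e u)\<^sup>2 / 4))) \<partial>count_space far)"
    proof (rule nn_integral_mono)
      fix u assume "u \<in> space (count_space far)"
      then have u: "u \<in> far" "u \<in> U" "u \<noteq> t" "y < (hell t u)\<^sup>2" by (auto simp: far_def)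
      have uL: "u \<in> L1_nonneg" using u UL by auto
      have "16 * (hell s t)\<^sup>2 \<le> (hell t u)\<^sup>2"
        using u(4) zero_le_power2[of "\<eta> m"] unfolding y_def by linarith
      then have "(4 * hell s t)\<^sup>2 \<le> (hell t u)\<^sup>2"
        by (simp add: power_mult_distrib)
      from power2_le_imp_le[OF this hell_nonneg[OF t uL]]
      have "hell s t \<le> hell t u / 4" by simp
      then have "prob (E u) \<le> exp (- (((hell t u)\<^sup>2 - (e t)\<^sup>2 + (e u)\<^sup>2) / 4))"
        using tests[unfolded valid_tests_def, rule_format, OF tU u(2) u(3)[symmetric]] finm
        unfolding E_def hell_def[of s] by simp
      also have "\<dots> \<le> exp (- ((hell t u)\<^sup>2 / 6) + - ((e u)\<^sup>2 / 4))"
      proof -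
        have "(e t)\<^sup>2 \<le> (\<eta> m)\<^sup>2"
          unfolding e_def using model_eta_le[of I \<eta> m t S] eta m by (intro power_mono) auto
        then have "3 * (e t)\<^sup>2 \<le> (hell t u)\<^sup>2"
          using u(4) zero_le_power2[of "hell s t"] unfolding y_def by linarith
        then show ?thesis unfolding exp_le_cancel_iff by (simp add: field_simps)
      qed
      finally have p: "prob (E u) \<le> exp (- ((hell t u)\<^sup>2 / 6)) * exp (- ((e u)\<^sup>2 / 4))"
        unfolding exp_add .
      have "(\<integral>\<^sup>+X. ennreal ((hell t u)\<^sup>2) * indicator (E u) X \<partial>?P) = ennreal ((hell t u)\<^sup>2 * prob (E u))"
        using E[OF u(1)] by (simp add: nn_integral_cmult_indicator emeasure_eq_measure ennreal_mult)
      also have "\<dots> \<le> ennreal ((hell t u)\<^sup>2 * exp (- ((hell t u)\<^sup>2 / 6)) * exp (- ((e u)\<^sup>2 / 4)))"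
        unfolding mult.assoc by (intro ennreal_leI mult_left_mono p) simp
      finally show "(\<integral>\<^sup>+X. ennreal ((hell t u)\<^sup>2) * indicator (E u) X \<partial>?P) \<le> \<dots>" .
    qed
    also have "\<dots> \<le> (\<integral>\<^sup>+u. ennreal ((hell t u)\<^sup>2 * exp (- ((hell t u)\<^sup>2 / 6)) * exp (- ((e u)\<^sup>2 / 4))) \<partial>count_space U)"
      by (auto simp: nn_integral_count_space_indicator far_def intro!: nn_integral_mono split: split_indicator)
    also have "\<dots> \<le> ennreal (risk_const I \<eta>)"
      unfolding U_def e_def risk_const_def by (rule family_sum_bound[OF fam t])
    finally show ?thesis .
  qed

  have "AE X in ?P. ennreal ((hell s (est X))\<^sup>2) \<le> ennreal (2 * (hell s t)\<^sup>2 + 2 * y) + 2 * Z X"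
  proof -
    have "AE X in ?P. \<forall>t\<in>U. T_criterion U \<psi> X (est X) \<le> T_criterion U \<psi> X t"
      by (rule min[OF finm]) simp
    then show ?thesis
    proof (rule AE_mp, intro AE_I2 impI)
      fix X assume X: "X \<in> space ?P"
        and le: "\<forall>t\<in>U. T_criterion U \<psi> X (est X) \<le> T_criterion U \<psi> X t"
      have v: "est X \<in> U" using measurable_space[OF meas] X space by auto
      then have vL: "est X \<in> L1_nonneg" using UL by auto
      show "ennreal ((hell s (est X))\<^sup>2) \<le> ennreal (2 * (hell s t)\<^sup>2 + 2 * y) + 2 * Z X"
      proof (cases "Z X")
        case top
        then show ?thesis by (simp add: ennreal_mult_top)
      next
        case (real z)
        have "hell t (est X) \<le> sqrt (y + z)"
        proof (rule T_estimator_pointwise[where I=I and S=S and \<psi>=\<psi> and X=X and e=e, folded U_def])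
          fix u assume u: "u \<in> U" "u \<noteq> t" "\<psi> t u X = u"
          have "(hell t u)\<^sup>2 \<le> y + z"
          proof (cases "y < (hell t u)\<^sup>2")
            case True
            then have "u \<in> far" using u by (simp add: far_def)
            then have "ennreal ((hell t u)\<^sup>2) * indicator (E u) X \<le> Z X"
              unfolding Z_def by (rule nn_integral_ge_point)
            then have "(hell t u)\<^sup>2 \<le> z"
              using real u X by (simp add: E_def)
            then show ?thesis using y0 by simp
          qed (use real in simp)
          then show "hell t u \<le> sqrt (y + z)" by (rule real_le_rsqrt)
        next
          show "X \<in> space (config_space cube_lebesgue)" using X space by simp
          show "T_criterion U \<psi> X (est X) \<le> T_criterion U \<psi> X t" using le tU by blast
          show "0 \<le> sqrt (y + z)" using y0 real by simp
        qed (fact UL tests tU v)+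
        then have "(hell t (est X))\<^sup>2 \<le> (sqrt (y + z))\<^sup>2"
          using hell_nonneg[OF t vL] by (rule power_mono)
        then have "(hell t (est X))\<^sup>2 \<le> y + z" using y0 real by simp
        then have "(hell s (est X))\<^sup>2 \<le> (2 * (hell s t)\<^sup>2 + 2 * y) + 2 * z"
          using hell_sq_triangle[OF s t vL] by simp
        then show ?thesis
          using real y0 by (simp add: ennreal_plus[symmetric] ennreal_leI ennreal_mult'[symmetric]
             ennreal_numeral[symmetric] del: ennreal_plus ennreal_numeral)
      qed
    qed
  qed
  then have "(\<integral>\<^sup>+ X. ennreal ((hell s (est X))\<^sup>2) \<partial>?P)
    \<le> (\<integral>\<^sup>+ X. ennreal (2 * (hell s t)\<^sup>2 + 2 * y) + 2 * Z X \<partial>?P)"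
    by (rule nn_integral_mono_AE)
  also have "\<dots> = ennreal (2 * (hell s t)\<^sup>2 + 2 * y) + 2 * (\<integral>\<^sup>+ X. Z X \<partial>?P)"
    using Z_meas by (simp add: nn_integral_add nn_integral_cmult emeasure_space_1)
  also have "\<dots> \<le> ennreal (2 * (hell s t)\<^sup>2 + 2 * y) + 2 * ennreal (risk_const I \<eta>)"
    using EZ by (intro add_left_mono mult_left_mono) auto
  also have "\<dots> = ennreal (34 * (hell s t)\<^sup>2 + 6 * (\<eta> m)\<^sup>2 + 2 * risk_const I \<eta>)"
  proof -
    have "2 * ennreal (risk_const I \<eta>) = ennreal (2 * risk_const I \<eta>)"
      using risk_const_nonneg[of I \<eta>] by (simp add: ennreal_mult)
    then show ?thesis
      using risk_const_nonneg[of I \<eta>] by (simp add: y_def ennreal_plus[symmetric] del: ennreal_plus)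
  qed
  finally show ?thesis .
qed

section \<open>Local polynomial approximation in one variable\<close>

text \<open>
  The derivatives at 0 are one-sided, so the statement is proved by induction on the order: the
  difference between \<open>g 0\<close> and its Taylor polynomial vanishes at \<open>x0\<close>, and its derivative is the
  remainder of one order less for \<open>g 1\<close>. The mean value theorem on \<open>{x0..y}\<close> gives one more factor
  \<open>y - x0\<close>.
\<close>

lemma taylor_hoelder:
  fixes g :: "nat \<Rightarrow> real \<Rightarrow> real"
  assumes "0 \<le> R" "0 < \<beta>" "0 \<le> x0"
    and "\<And>i x. i < p \<Longrightarrow> x \<in> {0..<1} \<Longrightarrow> (g i has_real_derivative g (Suc i) x) (at x within {0..<1})"
    and "\<And>x y. x \<in> {0..<1} \<Longrightarrow> y \<in> {0..<1} \<Longrightarrow> \<bar>g p x - g p y\<bar> \<le> R * \<bar>x - y\<bar> powr \<beta>"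
    and "y \<in> {x0..<1}"
  shows "\<bar>g 0 y - (\<Sum>i\<le>p. g i x0 / fact i * (y - x0) ^ i)\<bar> \<le> R * (y - x0) powr (\<beta> + real p)"
  using assms(4-)
proof (induction p arbitrary: g y)
  case 0
  have "\<bar>g 0 y - g 0 x0\<bar> \<le> R * \<bar>y - x0\<bar> powr \<beta>"
    by (rule 0(2)) (use 0(3) \<open>0 \<le> x0\<close> in auto)
  then show ?case using 0(3) by simp
next
  case (Suc p)
  define T where "T z = (\<Sum>i\<le>Suc p. g i x0 / fact i * (z - x0) ^ i)" for z
  define T' where "T' z = (\<Sum>i\<le>p. g (Suc i) x0 / fact i * (z - x0) ^ i)" for z
  have T': "(T has_real_derivative T' z) (at z within {x0..y})" for z
  proof -
    have "((\<lambda>z. g 0 x0 + (\<Sum>i\<le>p. g (Suc i) x0 / fact (Suc i) * (z - x0) ^ Suc i)) has_real_derivative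
        0 + (\<Sum>i\<le>p. g (Suc i) x0 / fact (Suc i) * (real (Suc i) * (z - x0) ^ i))) (at z within {x0..y})"
    proof (intro DERIV_add DERIV_const DERIV_sum)
      fix i
      show "((\<lambda>z. g (Suc i) x0 / fact (Suc i) * (z - x0) ^ Suc i) has_real_derivative
          g (Suc i) x0 / fact (Suc i) * (real (Suc i) * (z - x0) ^ i)) (at z within {x0..y})"
      proof (rule DERIV_cmult)
        have "((\<lambda>z. z - x0) has_real_derivative 1) (at z within {x0..y})"
          by (auto intro!: derivative_eq_intros)
        from DERIV_power[OF this, of "Suc i"]
        show "((\<lambda>z. (z - x0) ^ Suc i) has_real_derivative real (Suc i) * (z - x0) ^ i) (at z within {x0..y})"
          by simp
      qed
    qed
    moreover have "g (Suc i) x0 / fact (Suc i) * (real (Suc i) * (z - x0) ^ i) = g (Suc i) x0 / fact i * (z - x0) ^ i" for i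
      unfolding fact_Suc of_nat_mult by (simp del: of_nat_Suc)
    moreover have "T = (\<lambda>z. g 0 x0 + (\<Sum>i\<le>p. g (Suc i) x0 / fact (Suc i) * (z - x0) ^ Suc i))"
      unfolding T_def sum.atMost_Suc_shift by simp
    ultimately show ?thesis unfolding T'_def by (simp only: add_0)
  qed
  have rem: "\<bar>g (Suc 0) z - T' z\<bar> \<le> R * (z - x0) powr (\<beta> + real p)" if "z \<in> {x0..<1}" for z
    unfolding T'_def using Suc.IH[of "\<lambda>i. g (Suc i)" z] Suc.prems that by simp
  have "\<exists>\<xi>\<in>{x0..y}. (g 0 y - T y) - (g 0 x0 - T x0) = (g (Suc 0) \<xi> - T' \<xi>) * (y - x0)"
  proof (rule mvt_very_simple)
    show "x0 \<le> y" using Suc.prems(3) by simp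
    fix z assume z: "x0 \<le> z" "z \<le> y"
    have "(g 0 has_real_derivative g (Suc 0) z) (at z within {x0..y})"
      by (rule DERIV_subset[OF Suc.prems(1)]) (use z Suc.prems(3) \<open>0 \<le> x0\<close> in auto)
    then have "((\<lambda>z. g 0 z - T z) has_real_derivative g (Suc 0) z - T' z) (at z within {x0..y})"
      using T' by (rule DERIV_diff)
    then show "((\<lambda>z. g 0 z - T z) has_derivative (*) (g (Suc 0) z - T' z)) (at z within {x0..y})"
      by (simp add: has_field_derivative_def)
  qed
  moreover have "T x0 = g 0 x0"
    unfolding T_def sum.atMost_Suc_shift by simp
  ultimately obtain \<xi> where xi: "\<xi> \<in> {x0..y}" "g 0 y - T y = (g (Suc 0) \<xi> - T' \<xi>) * (y - x0)"
    by auto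
  have yx: "0 \<le> y - x0" using Suc.prems(3) by simp
  have "\<bar>g 0 y - T y\<bar> = \<bar>g (Suc 0) \<xi> - T' \<xi>\<bar> * (y - x0)"
    using yx unfolding xi(2) by (simp add: abs_mult)
  also have "\<dots> \<le> (R * (\<xi> - x0) powr (\<beta> + real p)) * (y - x0)"
    using xi(1) Suc.prems(3) yx by (intro mult_right_mono rem) auto
  also have "\<dots> \<le> (R * (y - x0) powr (\<beta> + real p)) * (y - x0)"
    using xi(1) yx assms(1,2) by (intro mult_right_mono mult_left_mono powr_mono2) auto
  also have "\<dots> = R * (y - x0) powr (\<beta> + real (Suc p))"
  proof (cases "y = x0")
    case False
    then have "(y - x0) powr (\<beta> + real (Suc p)) = (y - x0) powr (\<beta> + real p) * (y - x0) powr 1"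
      unfolding powr_add[symmetric] by (simp add: add_ac)
    then show ?thesis using yx by simp
  qed simp
  finally show ?case unfolding T_def .
qed

lemma hoelder_local_poly:
  assumes g: "g \<in> hoelder \<alpha> R" and r: "\<alpha> \<le> real r" and x0: "0 \<le> x0"
  obtains P where "degree P \<le> r" "\<And>y. y \<in> {x0..<1} \<Longrightarrow> \<bar>g y - poly P y\<bar> \<le> R * (y - x0) powr \<alpha>"
proof -
  obtain p \<beta> G where R: "0 < R" and \<alpha>: "\<alpha> = \<beta> + real p" and \<beta>: "0 < \<beta>"
    and G0: "\<forall>x\<in>{0..<1}. G 0 x = g x"
    and G1: "\<forall>i<p. \<forall>x\<in>{0..<1}. (G i has_real_derivative G (Suc i) x) (at x within {0..<1})"
    and Gp: "\<forall>x\<in>{0..<1}. \<forall>y\<in>{0..<1}. \<bar>G p x - G p y\<bar> \<le> R * \<bar>x - y\<bar> powr \<beta>"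
    using g unfolding hoelder_def by blast
  define P where "P = (\<Sum>i\<le>p. smult (G i x0 / fact i) ([:- x0, 1:] ^ i))"
  have "degree P \<le> p"
    unfolding P_def
  proof (rule degree_sum_le)
    fix i assume "i \<in> {..p}"
    then show "degree (smult (G i x0 / fact i) ([:- x0, 1:] ^ i)) \<le> p"
      by (intro order.trans[OF degree_smult_le]) (simp add: degree_linear_power)
  qed simp
  moreover have "p \<le> r" using r \<alpha> \<beta> by linarith
  moreover have "\<bar>g y - poly P y\<bar> \<le> R * (y - x0) powr \<alpha>" if y: "y \<in> {x0..<1}" for y
  proof -
    have "\<bar>G 0 y - (\<Sum>i\<le>p. G i x0 / fact i * (y - x0) ^ i)\<bar> \<le> R * (y - x0) powr (\<beta> + real p)"
      by (rule taylor_hoelder) (use R \<beta> x0 G1 Gp y in auto)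
    moreover have "G 0 y = g y" using G0 y x0 by simp
    ultimately show ?thesis by (simp add: P_def poly_sum \<alpha>)
  qed
  ultimately show thesis using that[of P] by auto
qed

section \<open>Lagrange interpolation on a cell\<close>

text \<open>The nodes are the integers \<open>0, \<dots>, r\<close>; the cell is later rescaled to \<open>[0, r + 1)\<close>.\<close>

definition lagrange_basis :: "nat \<Rightarrow> nat \<Rightarrow> real poly" where
  "lagrange_basis r a = (\<Prod>b\<in>{..r} - {a}. smult (1 / (real a - real b)) [:- real b, 1:])"

lemma degree_lagrange_basis: "a \<le> r \<Longrightarrow> degree (lagrange_basis r a) \<le> r"
proof -
  assume a: "a \<le> r"
  have "degree (lagrange_basis r a) \<le> (\<Sum>b\<in>{..r} - {a}. degree (smult (1 / (real a - real b)) [:- real b, 1:]))"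
    unfolding lagrange_basis_def by (rule order.trans[OF degree_prod_sum_le]) auto
  also have "\<dots> \<le> (\<Sum>b\<in>{..r} - {a}. 1)"
    by (rule sum_mono) (simp add: degree_smult_eq)
  also have "\<dots> = r" using a by simp
  finally show ?thesis .
qed

lemma lagrange_basis_node:
  assumes "b \<le> r"
  shows "poly (lagrange_basis r a) (real b) = (if a = b then 1 else 0)"
proof (cases "a = b")
  case True
  then show ?thesis
    by (auto simp: lagrange_basis_def poly_prod diff_divide_distrib[symmetric] intro!: prod.neutral)
next
  case False
  then have "\<exists>c\<in>{..r} - {a}. poly (smult (1 / (real a - real c)) [:- real c, 1:]) (real b) = 0"
    using assms by (intro bexI[of _ b]) auto
  then show ?thesis
    using False by (simp add: lagrange_basis_def poly_prod prod_zero_iff)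
qed

lemma lagrange_interpolation:
  assumes "degree Q \<le> r"
  shows "(\<Sum>a\<le>r. poly (lagrange_basis r a) z * poly Q (real a)) = poly Q z"
proof -
  define L where "L = (\<Sum>a\<le>r. smult (poly Q (real a)) (lagrange_basis r a))"
  have "L = Q"
  proof (rule poly_eqI_degree[where A="real ` {..r}"])
    fix x assume "x \<in> real ` {..r}"
    then obtain b where b: "b \<le> r" "x = real b" by auto
    have "poly L x = (\<Sum>a\<le>r. if a = b then poly Q x else 0)"
      unfolding L_def poly_sum by (rule sum.cong) (auto simp: lagrange_basis_node b)
    then show "poly L x = poly Q x" using b by simp
  next
    have card: "card (real ` {..r}) = Suc r"
      by (subst card_image) (auto simp: inj_on_def)
    have "degree L \<le> r"
      unfolding L_def
      by (rule degree_sum_le) (auto intro: order.trans[OF degree_smult_le] degree_lagrange_basis)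
    then show "degree L < card (real ` {..r})" using card by simp
    show "degree Q < card (real ` {..r})" using card assms by simp
  qed
  then have "poly Q z = poly L z" by simp
  then show ?thesis by (simp add: L_def poly_sum mult.commute)
qed

text \<open>An upper bound for the norm of the interpolation operator in the supremum norm.\<close>

definition lebesgue_bound :: "nat \<Rightarrow> real" where
  "lebesgue_bound r = real (Suc r) ^ Suc r"

lemma lebesgue_bound_ge_1: "1 \<le> lebesgue_bound r"
  unfolding lebesgue_bound_def by (rule one_le_power) simp

text \<open>In each factor the numerator is at most \<open>r + 1\<close> and, the nodes being distinct integers, the denominator at least 1.\<close>

lemma lagrange_basis_sum_bound:
  assumes "0 \<le> z" "z \<le> real r + 1"
  shows "(\<Sum>a\<le>r. \<bar>poly (lagrange_basis r a) z\<bar>) \<le> lebesgue_bound r"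
proof -
  have "\<bar>poly (lagrange_basis r a) z\<bar> \<le> real (Suc r) ^ r" if a: "a \<le> r" for a
  proof -
    have "\<bar>poly (lagrange_basis r a) z\<bar> = (\<Prod>b\<in>{..r} - {a}. \<bar>poly (smult (1 / (real a - real b)) [:- real b, 1:]) z\<bar>)"
      unfolding lagrange_basis_def poly_prod by (rule abs_prod)
    also have "\<dots> \<le> (\<Prod>b\<in>{..r} - {a}. real (Suc r))"
    proof (rule prod_mono, intro conjI)
      fix b assume b: "b \<in> {..r} - {a}"
      have "1 \<le> \<bar>real a - real b\<bar>" using b by (cases "a < b") auto
      moreover have "\<bar>z - real b\<bar> \<le> real (Suc r)" using assms b by auto
      ultimately have "\<bar>z - real b\<bar> / \<bar>real a - real b\<bar> \<le> real (Suc r) / 1"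
        by (intro frac_le) auto
      moreover have "poly (smult (1 / (real a - real b)) [:- real b, 1:]) z = (z - real b) / (real a - real b)"
        by (simp add: diff_divide_distrib)
      ultimately show "\<bar>poly (smult (1 / (real a - real b)) [:- real b, 1:]) z\<bar> \<le> real (Suc r)"
        by (simp only: abs_divide div_by_1)
    qed simp
    also have "\<dots> = real (Suc r) ^ r" using a by simp
    finally show ?thesis .
  qed
  then have "(\<Sum>a\<le>r. \<bar>poly (lagrange_basis r a) z\<bar>) \<le> (\<Sum>a\<le>r. real (Suc r) ^ r)"
    by (intro sum_mono) auto
  then show ?thesis by (simp add: lebesgue_bound_def)
qed

text \<open>
  The cell \<open>[i / N, (i + 1) / N)\<close> is mapped onto \<open>[0, r + 1)\<close> by \<open>x \<mapsto> (r + 1) * (N * x - i)\<close>. The factor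
  \<open>r + 1\<close> instead of \<open>r\<close> keeps the last node inside the half-open cell.
\<close>

definition cell_node :: "nat \<Rightarrow> nat \<Rightarrow> nat \<Rightarrow> nat \<Rightarrow> real" where
  "cell_node r N i a = (real i + real a / (real r + 1)) / real N"

definition cell_weight :: "nat \<Rightarrow> nat \<Rightarrow> nat \<Rightarrow> nat \<Rightarrow> real poly" where
  "cell_weight r N i a = pcompose (lagrange_basis r a) [:- (real r + 1) * real i, (real r + 1) * real N:]"

lemma cell_node_in_cell:
  assumes "0 < N" "a \<le> r"
  shows "real i / real N \<le> cell_node r N i a" "cell_node r N i a < (real i + 1) / real N"
proof -
  have a: "0 \<le> real a / (real r + 1)" "real a / (real r + 1) < 1"
    using assms by auto
  show "real i / real N \<le> cell_node r N i a"
    unfolding cell_node_def using a by (intro divide_right_mono) auto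
  show "cell_node r N i a < (real i + 1) / real N"
    unfolding cell_node_def using a assms by (intro divide_strict_right_mono) auto
qed

lemma degree_cell_weight: "a \<le> r \<Longrightarrow> degree (cell_weight r N i a) \<le> r"
proof -
  assume a: "a \<le> r"
  have "degree (cell_weight r N i a) \<le> degree (lagrange_basis r a) * degree [:- (real r + 1) * real i, (real r + 1) * real N:]"
    unfolding cell_weight_def by (rule degree_pcompose_le)
  also have "\<dots> \<le> r * 1"
    by (rule mult_mono) (use degree_lagrange_basis[OF a] in auto)
  finally show ?thesis by simp
qed

lemma cell_weight_sum_bound:
  assumes "0 < N" "real i / real N \<le> x" "x < (real i + 1) / real N"
  shows "(\<Sum>a\<le>r. \<bar>poly (cell_weight r N i a) x\<bar>) \<le> lebesgue_bound r"
proof -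
  have eq: "- (real r + 1) * real i + x * ((real r + 1) * real N) = (real r + 1) * (real N * x - real i)"
    by (simp add: algebra_simps)
  have "0 \<le> real N * x - real i" "real N * x - real i \<le> 1"
    using assms by (auto simp: field_simps)
  then have "0 \<le> (real r + 1) * (real N * x - real i)" "(real r + 1) * (real N * x - real i) \<le> real r + 1"
    by (auto simp: mult_le_cancel_left1)
  from lagrange_basis_sum_bound[OF this] show ?thesis
    by (simp add: cell_weight_def poly_pcompose eq[simplified])
qed

lemma cell_interpolation:
  assumes "0 < N" "degree P \<le> r"
  shows "(\<Sum>a\<le>r. poly (cell_weight r N i a) x * poly P (cell_node r N i a)) = poly P x"
proof -
  define Q where "Q = pcompose P [:real i / real N, 1 / ((real r + 1) * real N):]"
  have "degree Q \<le> degree P * degree [:real i / real N, 1 / ((real r + 1) * real N):]"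
    unfolding Q_def by (rule degree_pcompose_le)
  also have "\<dots> \<le> r * 1" by (rule mult_mono) (use assms in auto)
  finally have Q: "degree Q \<le> r" by simp
  define z where "z = - (real r + 1) * real i + x * ((real r + 1) * real N)"
  have "poly Q z = poly P x"
  proof -
    have "real i / real N + z * (1 / ((real r + 1) * real N)) = x"
    proof -
      have "z = ((real r + 1) * real N) * (x - real i / real N)"
        using assms(1) by (simp add: z_def algebra_simps)
      then show ?thesis using assms(1) by simp
    qed
    then show ?thesis by (simp add: Q_def poly_pcompose)
  qed
  moreover have "poly Q (real a) = poly P (cell_node r N i a)" for a
  proof -
    have "real i / real N + real a * (1 / ((real r + 1) * real N)) = cell_node r N i a"
      using assms(1) by (simp add: cell_node_def add_divide_distrib)
    then show ?thesis by (simp add: Q_def poly_pcompose)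
  qed
  moreover have "poly (cell_weight r N i a) x = poly (lagrange_basis r a) z" for a
    by (simp add: cell_weight_def poly_pcompose z_def)
  ultimately show ?thesis using lagrange_interpolation[OF Q, of z] by simp
qed

text \<open>
  Interpolation reproduces the Taylor polynomial at the left end of the cell, so only
  the Taylor remainder has to be interpolated, and it is at most \<open>R * N powr (- \<alpha>)\<close> everywhere on the cell.
\<close>

lemma cell_interpolation_error:
  assumes g: "g \<in> hoelder \<alpha> R" and r: "\<alpha> \<le> real r" and i: "i < N"
    and x: "real i / real N \<le> x" "x < (real i + 1) / real N"
  shows "\<bar>g x - (\<Sum>a\<le>r. poly (cell_weight r N i a) x * g (cell_node r N i a))\<bar>
    \<le> 2 * lebesgue_bound r * (R * real N powr (- \<alpha>))"
proof -
  have N: "0 < N" using i by simp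
  have R: "0 < R" and \<alpha>: "0 < \<alpha>" using g by (auto simp: hoelder_def)
  define x0 where "x0 = real i / real N"
  have x0: "0 \<le> x0" by (simp add: x0_def)
  obtain P where P: "degree P \<le> r" "\<And>y. y \<in> {x0..<1} \<Longrightarrow> \<bar>g y - poly P y\<bar> \<le> R * (y - x0) powr \<alpha>"
    using hoelder_local_poly[OF g r x0] by blast
  define E where "E = R * real N powr (- \<alpha>)"
  have E0: "0 \<le> E" using R by (simp add: E_def)
  have close: "\<bar>g y - poly P y\<bar> \<le> E" if y: "real i / real N \<le> y" "y < (real i + 1) / real N" for y
  proof -
    have "(real i + 1) / real N \<le> 1" using i by simp
    then have "\<bar>g y - poly P y\<bar> \<le> R * (y - x0) powr \<alpha>"
      using y by (intro P) (simp add: x0_def)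
    also have "\<dots> \<le> R * (1 / real N) powr \<alpha>"
      using R \<alpha> y by (intro mult_left_mono powr_mono2) (auto simp: x0_def add_divide_distrib)
    also have "\<dots> = E" by (simp add: E_def powr_divide powr_minus_divide)
    finally show ?thesis .
  qed
  let ?w = "\<lambda>a. poly (cell_weight r N i a) x"
  let ?d = "\<lambda>a. g (cell_node r N i a) - poly P (cell_node r N i a)"
  have eq: "g x - (\<Sum>a\<le>r. ?w a * g (cell_node r N i a)) = (g x - poly P x) - (\<Sum>a\<le>r. ?w a * ?d a)"
    using cell_interpolation[OF N P(1), of i x] by (simp add: right_diff_distrib sum_subtractf)
  have "\<bar>\<Sum>a\<le>r. ?w a * ?d a\<bar> \<le> (\<Sum>a\<le>r. \<bar>?w a * ?d a\<bar>)" by (rule sum_abs)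
  also have "\<dots> \<le> (\<Sum>a\<le>r. \<bar>?w a\<bar> * E)"
  proof (rule sum_mono)
    fix a assume "a \<in> {..r}"
    then have "\<bar>?d a\<bar> \<le> E" using cell_node_in_cell[OF N, of a r i] by (intro close) simp_all
    then show "\<bar>?w a * ?d a\<bar> \<le> \<bar>?w a\<bar> * E" unfolding abs_mult by (rule mult_left_mono) simp
  qed
  also have "\<dots> \<le> lebesgue_bound r * E"
    unfolding sum_distrib_right[symmetric] by (rule mult_right_mono[OF cell_weight_sum_bound[OF N x] E0])
  finally have "\<bar>\<Sum>a\<le>r. ?w a * ?d a\<bar> \<le> lebesgue_bound r * E" .
  then have "\<bar>g x - (\<Sum>a\<le>r. ?w a * g (cell_node r N i a))\<bar> \<le> E + lebesgue_bound r * E"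
    unfolding eq using close[OF x] by linarith
  also have "\<dots> \<le> 2 * lebesgue_bound r * E"
    using mult_right_mono[OF lebesgue_bound_ge_1 E0, of r] by linarith
  finally show ?thesis unfolding E_def .
qed

section \<open>Tensor interpolation\<close>

text \<open>
  Interpolation in the coordinates from \<open>J\<close> with weights \<open>w\<close> and nodes \<open>nd\<close>; the other
  coordinates of \<open>x\<close> are left alone, so that coordinates can be added one at a time.
\<close>

definition tensor_interpolant ::
    "nat \<Rightarrow> ('n \<Rightarrow> nat \<Rightarrow> real \<Rightarrow> real) \<Rightarrow> ('n \<Rightarrow> nat \<Rightarrow> real) \<Rightarrow> (real ^ 'n \<Rightarrow> real) \<Rightarrow> 'n set \<Rightarrow> real ^ 'n \<Rightarrow> real" where
  "tensor_interpolant r w nd f J x =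
     (\<Sum>a\<in>J \<rightarrow>\<^sub>E {..r}. (\<Prod>j\<in>J. w j (a j) (x $ j)) * f (\<chi> l. if l \<in> J then nd l (a l) else x $ l))"

lemma tensor_interpolant_insert:
  fixes J :: "'n :: finite set"
  assumes "j \<notin> J"
  shows "tensor_interpolant r w nd f (insert j J) x =
    (\<Sum>b\<le>r. w j b (x $ j) * tensor_interpolant r w nd f J (\<chi> l. if l = j then nd j b else x $ l))"
proof -
  let ?F = "\<lambda>a. (\<Prod>l\<in>insert j J. w l (a l) (x $ l)) * f (\<chi> l. if l \<in> insert j J then nd l (a l) else x $ l)"
  have "tensor_interpolant r w nd f (insert j J) x = sum ?F ((\<lambda>(b, a). a(j := b)) ` ({..r} \<times> (J \<rightarrow>\<^sub>E {..r})))"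
    unfolding tensor_interpolant_def PiE_insert_eq ..
  also have "\<dots> = (\<Sum>p\<in>{..r} \<times> (J \<rightarrow>\<^sub>E {..r}). ?F ((snd p)(j := fst p)))"
    by (simp only: sum.reindex[OF inj_combinator[OF assms, of "\<lambda>_. {..r}"]] comp_def case_prod_beta)
  also have "\<dots> = (\<Sum>b\<le>r. \<Sum>a\<in>J \<rightarrow>\<^sub>E {..r}. ?F (a(j := b)))"
    by (simp only: sum.cartesian_product case_prod_unfold)
  also have "\<dots> = (\<Sum>b\<le>r. w j b (x $ j) * tensor_interpolant r w nd f J (\<chi> l. if l = j then nd j b else x $ l))"
  proof (rule sum.cong)
    fix b
    have "?F (a(j := b)) = w j b (x $ j) * ((\<Prod>l\<in>J. w l (a l) ((\<chi> l. if l = j then nd j b else x $ l) $ l))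
        * f (\<chi> l. if l \<in> J then nd l (a l) else (\<chi> l. if l = j then nd j b else x $ l) $ l))" for a
    proof -
      have "(\<Prod>l\<in>J. w l ((a(j := b)) l) (x $ l)) = (\<Prod>l\<in>J. w l (a l) ((\<chi> l. if l = j then nd j b else x $ l) $ l))"
        using assms by (intro prod.cong) auto
      moreover have "(\<chi> l. if l \<in> insert j J then nd l ((a(j := b)) l) else x $ l)
         = (\<chi> l. if l \<in> J then nd l (a l) else (\<chi> l. if l = j then nd j b else x $ l) $ l)"
        using assms by (auto simp: vec_eq_iff)
      ultimately show ?thesis using assms by simp
    qed
    then show "(\<Sum>a\<in>J \<rightarrow>\<^sub>E {..r}. ?F (a(j := b)))
      = w j b (x $ j) * tensor_interpolant r w nd f J (\<chi> l. if l = j then nd j b else x $ l)"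
      unfolding tensor_interpolant_def sum_distrib_left by (intro sum.cong) auto
  qed simp
  finally show ?thesis .
qed

text \<open>
  With \<open>L\<^sub>J\<close> for the interpolation in the coordinates \<open>J\<close>, the identity
  \<open>f - L\<^sub>j (L\<^sub>J f) = (f - L\<^sub>j f) + L\<^sub>j (f - L\<^sub>J f)\<close> shows that a new coordinate adds its own error and
  multiplies the previous ones by the norm \<open>\<Lambda>\<close>.
\<close>

lemma tensor_interpolant_error:
  fixes f :: "real ^ 'n \<Rightarrow> real" and x :: "real ^ 'n"
  assumes stable: "\<And>x j b. x \<in> Q \<Longrightarrow> b \<le> r \<Longrightarrow> (\<chi> l. if l = j then nd j b else x $ l) \<in> Q"
    and weights: "\<And>x j. x \<in> Q \<Longrightarrow> (\<Sum>b\<le>r. \<bar>w j b (x $ j)\<bar>) \<le> \<Lambda>"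
    and \<Lambda>: "1 \<le> \<Lambda>"
    and error: "\<And>x j. x \<in> Q \<Longrightarrow>
      \<bar>f x - (\<Sum>b\<le>r. w j b (x $ j) * f (\<chi> l. if l = j then nd j b else x $ l))\<bar> \<le> \<epsilon> j"
    and J: "finite J" and x: "x \<in> Q"
  shows "\<bar>f x - tensor_interpolant r w nd f J x\<bar> \<le> \<Lambda> ^ card J * (\<Sum>j\<in>J. \<epsilon> j)"
  using J x
proof (induction J arbitrary: x rule: finite_induct)
  case empty
  then show ?case by (simp add: tensor_interpolant_def)
next
  case (insert j J)
  let ?x = "\<lambda>b. \<chi> l. if l = j then nd j b else x $ l"
  let ?w = "\<lambda>b. w j b (x $ j)"
  let ?B = "\<Lambda> ^ card J * (\<Sum>j\<in>J. \<epsilon> j)"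
  have \<epsilon>: "0 \<le> \<epsilon> l" for l using error[OF insert.prems, of l] by simp
  then have B0: "0 \<le> ?B" using \<Lambda> by (intro mult_nonneg_nonneg sum_nonneg) auto
  let ?d = "\<lambda>b. f (?x b) - tensor_interpolant r w nd f J (?x b)"
  have eq: "f x - tensor_interpolant r w nd f (insert j J) x
      = (f x - (\<Sum>b\<le>r. ?w b * f (?x b))) + (\<Sum>b\<le>r. ?w b * ?d b)"
    by (simp add: tensor_interpolant_insert[OF insert.hyps(2)] right_diff_distrib sum_subtractf)
  have "\<bar>\<Sum>b\<le>r. ?w b * ?d b\<bar> \<le> (\<Sum>b\<le>r. \<bar>?w b * ?d b\<bar>)" by (rule sum_abs)
  also have "\<dots> \<le> (\<Sum>b\<le>r. \<bar>?w b\<bar> * ?B)"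
  proof (rule sum_mono)
    fix b assume "b \<in> {..r}"
    then have "\<bar>?d b\<bar> \<le> ?B" by (intro insert.IH stable insert.prems) simp
    then show "\<bar>?w b * ?d b\<bar> \<le> \<bar>?w b\<bar> * ?B" unfolding abs_mult by (rule mult_left_mono) simp
  qed
  also have "\<dots> \<le> \<Lambda> * ?B"
    unfolding sum_distrib_right[symmetric] by (rule mult_right_mono[OF weights[OF insert.prems] B0])
  finally have "\<bar>\<Sum>b\<le>r. ?w b * ?d b\<bar> \<le> \<Lambda> * ?B" .
  then have "\<bar>f x - tensor_interpolant r w nd f (insert j J) x\<bar> \<le> \<epsilon> j + \<Lambda> * ?B"
    unfolding eq using error[OF insert.prems, of j] by linarith
  also have "\<dots> \<le> \<Lambda> ^ Suc (card J) * \<epsilon> j + \<Lambda> * ?B"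
    using mult_right_mono[OF one_le_power[OF \<Lambda>, of "Suc (card J)"] \<epsilon>[of j]] by simp
  also have "\<dots> = \<Lambda> ^ card (insert j J) * (\<Sum>j\<in>insert j J. \<epsilon> j)"
    using insert.hyps by (simp add: algebra_simps)
  finally show ?case .
qed

definition cell_interpolant :: "nat \<Rightarrow> nat ^ 'n \<Rightarrow> nat ^ 'n \<Rightarrow> (real ^ 'n \<Rightarrow> real) \<Rightarrow> real ^ 'n \<Rightarrow> real" where
  "cell_interpolant r N i f =
     tensor_interpolant r (\<lambda>j a. poly (cell_weight r (N $ j) (i $ j) a)) (\<lambda>j. cell_node r (N $ j) (i $ j)) f UNIV"

text \<open>Expand the product over the coordinates of the univariate weights into monomials, and collect the coefficients over all nodes.\<close>

lemma cell_interpolant_poly: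
  fixes N i :: "nat ^ 'n"
  shows "\<exists>c. \<forall>x. cell_interpolant r N i f x = (\<Sum>e\<in>{e :: 'n \<Rightarrow> nat. \<forall>j. e j \<le> r}. c e * (\<Prod>j\<in>UNIV. (x $ j) ^ e j))"
proof -
  have PiE: "UNIV \<rightarrow>\<^sub>E {..r} = {e :: 'n \<Rightarrow> nat. \<forall>j. e j \<le> r}"
    by (auto simp: PiE_def Pi_def)
  let ?A = "{e :: 'n \<Rightarrow> nat. \<forall>j. e j \<le> r}"
  let ?q = "\<lambda>a j. cell_weight r (N $ j) (i $ j) (a j)"
  define v where "v a = f (\<chi> l. cell_node r (N $ l) (i $ l) (a l))" for a
  have "cell_interpolant r N i f x = (\<Sum>e\<in>?A. (\<Sum>a\<in>?A. v a * (\<Prod>j\<in>UNIV. coeff (?q a j) (e j))) * (\<Prod>j\<in>UNIV. (x $ j) ^ e j))" for x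
  proof -
    have "(\<Prod>j\<in>UNIV. poly (?q a j) (x $ j)) = (\<Sum>e\<in>?A. (\<Prod>j\<in>UNIV. coeff (?q a j) (e j)) * (\<Prod>j\<in>UNIV. (x $ j) ^ e j))"
      if a: "a \<in> ?A" for a
    proof -
      have "poly (?q a j) (x $ j) = (\<Sum>k\<le>r. coeff (?q a j) k * (x $ j) ^ k)" for j
      proof -
        have "degree (?q a j) \<le> r" using a by (intro degree_cell_weight) simp
        then show ?thesis
          unfolding poly_altdef by (intro sum.mono_neutral_left) (auto simp: coeff_eq_0)
      qed
      then have "(\<Prod>j\<in>UNIV. poly (?q a j) (x $ j)) = (\<Prod>j\<in>UNIV. \<Sum>k\<le>r. coeff (?q a j) k * (x $ j) ^ k)"
        by simp
      also have "\<dots> = (\<Sum>e\<in>UNIV \<rightarrow>\<^sub>E {..r}. \<Prod>j\<in>UNIV. coeff (?q a j) (e j) * (x $ j) ^ e j)"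
        by (rule prod_sum_PiE) auto
      finally show ?thesis unfolding PiE prod.distrib .
    qed
    then have "cell_interpolant r N i f x = (\<Sum>a\<in>?A. (\<Sum>e\<in>?A. (\<Prod>j\<in>UNIV. coeff (?q a j) (e j)) * (\<Prod>j\<in>UNIV. (x $ j) ^ e j)) * v a)"
      unfolding cell_interpolant_def tensor_interpolant_def PiE v_def by simp
    also have "\<dots> = (\<Sum>e\<in>?A. \<Sum>a\<in>?A. v a * (\<Prod>j\<in>UNIV. coeff (?q a j) (e j)) * (\<Prod>j\<in>UNIV. (x $ j) ^ e j))"
      unfolding sum_distrib_right by (subst sum.swap) (simp add: mult_ac)
    finally show ?thesis by (simp add: sum_distrib_right)
  qed
  then show ?thesis by (intro exI allI)
qed

definition cell_index :: "nat ^ 'n \<Rightarrow> real ^ 'n \<Rightarrow> nat ^ 'n" where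
  "cell_index N x = (\<chi> j. nat \<lfloor>real (N $ j) * x $ j\<rfloor>)"

lemma cell_index_eq:
  assumes "\<And>j. 0 < N $ j" "x \<in> grid_cell N i"
  shows "cell_index N x = i"
proof -
  have "\<lfloor>real (N $ j) * x $ j\<rfloor> = int (i $ j)" for j
  proof -
    have "real (i $ j) / real (N $ j) \<le> x $ j" "x $ j < (real (i $ j) + 1) / real (N $ j)"
      using assms(2) by (simp_all add: grid_cell_def)
    then show ?thesis
      using assms(1)[of j] by (intro floor_unique) (simp_all add: field_simps)
  qed
  then show ?thesis by (simp add: cell_index_def vec_eq_iff)
qed

lemma cell_index:
  assumes "\<And>j. 0 < N $ j" "x \<in> unit_cube"
  shows "cell_index N x $ j < N $ j" "x \<in> grid_cell N (cell_index N x)"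
proof -
  have x: "0 \<le> x $ j" "x $ j < 1" for j using assms(2) by (auto simp: unit_cube_def)
  have fl: "real (cell_index N x $ j) = of_int \<lfloor>real (N $ j) * x $ j\<rfloor>" for j
    using x[of j] by (simp add: cell_index_def)
  have lo: "real (cell_index N x $ j) \<le> real (N $ j) * x $ j"
    and hi: "real (N $ j) * x $ j < real (cell_index N x $ j) + 1" for j
    unfolding fl by linarith+
  have "real (N $ j) * x $ j < real (N $ j) * 1"
    using x assms(1) by (intro mult_strict_left_mono) auto
  then show "cell_index N x $ j < N $ j" using lo[of j] by simp
  show "x \<in> grid_cell N (cell_index N x)"
    using lo hi assms(1) by (auto simp: grid_cell_def field_simps)
qed

lemma grid_cell_subset_cube:
  assumes "\<And>j. i $ j < N $ j"
  shows "grid_cell N i \<subseteq> unit_cube"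
proof
  fix x assume x: "x \<in> grid_cell N i"
  have "0 \<le> x $ j \<and> x $ j < 1" for j
  proof -
    have "0 \<le> real (i $ j) / real (N $ j)" by simp
    moreover have "(real (i $ j) + 1) / real (N $ j) \<le> 1" using assms[of j] by simp
    moreover have "real (i $ j) / real (N $ j) \<le> x $ j" "x $ j < (real (i $ j) + 1) / real (N $ j)"
      using x by (simp_all add: grid_cell_def)
    ultimately show ?thesis by linarith
  qed
  then show "x \<in> unit_cube" by (simp add: unit_cube_def)
qed

theorem aniso_hoelder_approximation:
  fixes f :: "real ^ 'n \<Rightarrow> real"
  assumes f: "f \<in> aniso_hoelder \<alpha> R" and r: "\<And>j. \<alpha> $ j \<le> real r" and N: "\<And>j. 0 < N $ j"
  shows "\<exists>v\<in>piecewise_poly (N, r). \<forall>x\<in>unit_cube.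
    \<bar>f x - v x\<bar> \<le> lebesgue_bound r ^ CARD('n) *
      (\<Sum>j\<in>UNIV. 2 * lebesgue_bound r * (R $ j * real (N $ j) powr (- (\<alpha> $ j))))"
proof (intro bexI ballI)
  define v where "v x = cell_interpolant r N (cell_index N x) f x" for x
  show "v \<in> piecewise_poly (N, r)"
  proof -
    have "\<exists>c. \<forall>x\<in>grid_cell N i. v x = (\<Sum>e\<in>{e :: 'n \<Rightarrow> nat. \<forall>j. e j \<le> r}. c e * (\<Prod>j\<in>UNIV. (x $ j) ^ e j))" for i
      using cell_interpolant_poly[of r N i f] cell_index_eq[OF N] by (auto simp: v_def)
    then show ?thesis by (simp add: piecewise_poly_def)
  qed
  fix x :: "real ^ 'n" assume x: "x \<in> unit_cube"
  define i where "i = cell_index N x"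
  have i: "i $ j < N $ j" for j unfolding i_def by (rule cell_index(1)[OF N x])
  have cell: "x \<in> grid_cell N i" unfolding i_def by (rule cell_index(2)[OF N x])
  show "\<bar>f x - v x\<bar> \<le> lebesgue_bound r ^ CARD('n) *
      (\<Sum>j\<in>UNIV. 2 * lebesgue_bound r * (R $ j * real (N $ j) powr (- (\<alpha> $ j))))"
    unfolding v_def i_def[symmetric] cell_interpolant_def
  proof (rule tensor_interpolant_error[where Q="grid_cell N i"])
    fix x j b assume xc: "x \<in> grid_cell N i" and b: "b \<le> r"
    then show "(\<chi> l. if l = j then cell_node r (N $ j) (i $ j) b else x $ l) \<in> grid_cell N i"
      using cell_node_in_cell[OF N b] by (auto simp: grid_cell_def)
  next
    fix x j assume xc: "x \<in> grid_cell N i"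
    then have xj: "real (i $ j) / real (N $ j) \<le> x $ j" "x $ j < (real (i $ j) + 1) / real (N $ j)"
      by (auto simp: grid_cell_def)
    show "(\<Sum>b\<le>r. \<bar>poly (cell_weight r (N $ j) (i $ j) b) (x $ j)\<bar>) \<le> lebesgue_bound r"
      by (rule cell_weight_sum_bound[OF N xj])
    have "x \<in> unit_cube" using grid_cell_subset_cube[of i N] i xc by blast
    then have slice: "(\<lambda>y. f (\<chi> l. if l = j then y else x $ l)) \<in> hoelder (\<alpha> $ j) (R $ j)"
      using f by (simp add: aniso_hoelder_def)
    have "(\<chi> l. if l = j then x $ j else x $ l) = x" by (simp add: vec_eq_iff)
    then show "\<bar>f x - (\<Sum>b\<le>r. poly (cell_weight r (N $ j) (i $ j) b) (x $ j) *
          f (\<chi> l. if l = j then cell_node r (N $ j) (i $ j) b else x $ l))\<bar>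
      \<le> 2 * lebesgue_bound r * (R $ j * real (N $ j) powr (- (\<alpha> $ j)))"
      using cell_interpolation_error[OF slice r i xj] by simp
  qed (use cell lebesgue_bound_ge_1 in auto)
qed

section \<open>Linear models and the choice of the grid\<close>

text \<open>
  The distance from \<open>s\<close> to \<open>S m\<close> need not be attained. Enlarging the factor 2.2 to 3 makes room for a
  point \<open>t\<close> of \<open>S m\<close>, since \<open>linear_eta\<close> is positive. The additive \<open>risk_const\<close> is absorbed because
  the square of \<open>linear_eta\<close> is at least 1.
\<close>

theorem linear_T_estimator_risk:
  fixes s :: "real ^ 'n \<Rightarrow> real"
  assumes est: "linear_T_estimator I V Dbar \<Delta> est" and s: "s \<in> L1_nonneg"
    and m: "m \<in> I" and v: "v \<in> V m"
  shows "(\<integral>\<^sup>+ X. ennreal ((hell s (est X))\<^sup>2) \<partial>poisson_process (intensity_measure s))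
    \<le> ennreal ((618 + 2 * risk_const I (linear_eta Dbar \<Delta>)) *
        ((L2_norm (\<lambda>x. sqrt (s x) - v x))\<^sup>2 + (linear_eta Dbar \<Delta> m)\<^sup>2))"
proof -
  define \<eta> where "\<eta> = linear_eta Dbar \<Delta>"
  define K where "K = risk_const I \<eta>"
  define L where "L = L2_norm (\<lambda>x. sqrt (s x) - v x)"
  have L0: "0 \<le> L" by (simp add: L_def L2_norm_def)
  have K0: "0 \<le> K" unfolding K_def by (rule risk_const_nonneg)
  obtain S where fam: "D_model_family I S \<eta> (\<lambda>m. 9 * real (Dbar m)) 1"
    and near: "\<forall>m\<in>I. \<forall>t\<in>L1_nonneg. (INF u\<in>S m. ennreal (hell t u))
             \<le> ennreal (22 / 10) * ((INF u\<in>V m. ennreal (L2_norm (\<lambda>x. sqrt (t x) - u x))) + ennreal (\<eta> m))"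
    and T: "T_estimator I S \<eta> est"
    using est unfolding linear_T_estimator_def \<eta>_def by blast
  have model: "D_model L1_nonneg hell (S m) (\<eta> m) (9 * real (Dbar m)) 1"
    and D: "1 / 2 \<le> 9 * real (Dbar m)" "84 * (9 * real (Dbar m)) / 5 \<le> (\<eta> m)\<^sup>2"
    using fam m unfolding D_model_family_def by blast+
  have eta: "0 < \<eta> m" using model by (simp add: D_model_def)
  have eta1: "1 \<le> (\<eta> m)\<^sup>2" using D by simp
  have "(INF u\<in>V m. ennreal (L2_norm (\<lambda>x. sqrt (s x) - u x))) \<le> ennreal L"
    unfolding L_def using v by (rule INF_lower)
  then have "ennreal (22 / 10) * ((INF u\<in>V m. ennreal (L2_norm (\<lambda>x. sqrt (s x) - u x))) + ennreal (\<eta> m))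
      \<le> ennreal (22 / 10) * (ennreal L + ennreal (\<eta> m))"
    by (intro mult_left_mono add_right_mono) auto
  also have "\<dots> = ennreal (22 / 10 * (L + \<eta> m))"
    using L0 eta by (simp add: ennreal_mult[symmetric] ennreal_plus[symmetric] del: ennreal_plus)
  also have "\<dots> < ennreal (3 * (L + \<eta> m))"
    using L0 eta by (intro ennreal_lessI) auto
  finally have "(INF u\<in>S m. ennreal (hell s u)) < ennreal (3 * (L + \<eta> m))"
    using near m s by (meson le_less_trans)
  then obtain t where t: "t \<in> S m" "ennreal (hell s t) < ennreal (3 * (L + \<eta> m))"
    unfolding INF_less_iff by blast
  have tL: "t \<in> L1_nonneg" using t(1) model by (auto simp: D_model_def)
  have "hell s t \<le> 3 * (L + \<eta> m)"
    using t(2) unfolding ennreal_less_iff[OF hell_nonneg[OF s tL]] by simp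
  then have "(hell s t)\<^sup>2 \<le> (3 * (L + \<eta> m))\<^sup>2"
    using hell_nonneg[OF s tL] by (rule power_mono)
  also have "\<dots> = 9 * (L\<^sup>2 + 2 * L * \<eta> m + (\<eta> m)\<^sup>2)" by (simp add: power2_eq_square algebra_simps)
  also have "\<dots> \<le> 18 * (L\<^sup>2 + (\<eta> m)\<^sup>2)" using sum_squares_bound[of L "\<eta> m"] by simp
  finally have "(hell s t)\<^sup>2 \<le> 18 * (L\<^sup>2 + (\<eta> m)\<^sup>2)" .
  then have "34 * (hell s t)\<^sup>2 \<le> 34 * (18 * (L\<^sup>2 + (\<eta> m)\<^sup>2))" by simp
  moreover have "2 * (K * 1) \<le> 2 * (K * (L\<^sup>2 + (\<eta> m)\<^sup>2))"
    using eta1 K0 by (intro mult_left_mono) (auto intro: order.trans[of _ "(\<eta> m)\<^sup>2"])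
  moreover have "6 * (\<eta> m)\<^sup>2 \<le> 6 * (L\<^sup>2 + (\<eta> m)\<^sup>2)" by simp
  ultimately have "34 * (hell s t)\<^sup>2 + 6 * (\<eta> m)\<^sup>2 + 2 * K
      \<le> 34 * (18 * (L\<^sup>2 + (\<eta> m)\<^sup>2)) + 6 * (L\<^sup>2 + (\<eta> m)\<^sup>2) + 2 * (K * (L\<^sup>2 + (\<eta> m)\<^sup>2))"
    unfolding mult_1_right by (intro add_mono)
  also have "\<dots> = (618 + 2 * K) * (L\<^sup>2 + (\<eta> m)\<^sup>2)" by (simp add: algebra_simps)
  finally have "34 * (hell s t)\<^sup>2 + 6 * (\<eta> m)\<^sup>2 + 2 * K \<le> (618 + 2 * K) * (L\<^sup>2 + (\<eta> m)\<^sup>2)" .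
  from order.trans[OF T_estimator_risk[OF fam T s m t(1)] ennreal_leI[OF this[unfolded K_def]]]
  show ?thesis unfolding K_def L_def \<eta>_def .
qed

lemma emeasure_unit_cube_le: "emeasure lborel (unit_cube :: (real ^ 'n) set) \<le> 1"
proof -
  have "emeasure lborel (unit_cube :: (real ^ 'n) set) \<le> emeasure lborel (cbox 0 1 :: (real ^ 'n) set)"
    by (rule emeasure_mono) (auto simp: unit_cube_def mem_box_cart less_imp_le)
  also have "\<dots> = 1"
  proof -
    have "(1 - 0 :: real ^ 'n) \<bullet> b = 1" "(0 :: real ^ 'n) \<bullet> b \<le> 1 \<bullet> b" if "b \<in> Basis" for b
      using that by (auto simp: Basis_vec_def inner_axis)
    then show ?thesis by (simp add: emeasure_lborel_cbox_eq)
  qed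
  finally show ?thesis .
qed

lemma L2_norm_le_sup:
  fixes f :: "real ^ 'n \<Rightarrow> real"
  assumes E: "0 \<le> E" and f: "\<And>x. x \<in> unit_cube \<Longrightarrow> \<bar>f x\<bar> \<le> E"
  shows "L2_norm f \<le> E"
proof -
  have "(\<integral>x. (f x)\<^sup>2 \<partial>cube_lebesgue) \<le> E\<^sup>2"
  proof (cases "integrable cube_lebesgue (\<lambda>x. (f x)\<^sup>2)")
    case True
    have em: "emeasure cube_lebesgue (space cube_lebesgue :: (real ^ 'n) set) \<le> 1"
      unfolding space_cube_lebesgue using emeasure_unit_cube_le unit_cube_borel
      by (subst emeasure_restrict_space) auto
    then interpret finite_measure "cube_lebesgue :: (real ^ 'n) measure"
      by (intro finite_measureI) (auto simp: top_unique)
    have "measure cube_lebesgue (space cube_lebesgue :: (real ^ 'n) set) \<le> 1"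
      using em by (simp add: emeasure_eq_measure)
    moreover have "(\<integral>x. (f x)\<^sup>2 \<partial>cube_lebesgue) \<le> (\<integral>x. E\<^sup>2 \<partial>(cube_lebesgue :: (real ^ 'n) measure))"
    proof (rule integral_mono[OF True])
      fix x :: "real ^ 'n" assume "x \<in> space cube_lebesgue"
      then have "\<bar>f x\<bar> \<le> \<bar>E\<bar>" using f[of x] E by (simp add: space_cube_lebesgue)
      then show "(f x)\<^sup>2 \<le> E\<^sup>2" by (simp only: abs_le_square_iff)
    qed simp
    ultimately show ?thesis
      using mult_right_mono[of "measure cube_lebesgue (space cube_lebesgue :: (real ^ 'n) set)" 1 "E\<^sup>2"] by simp
  next
    case False
    then show ?thesis by (simp add: not_integrable_integral_eq)
  qed
  then show ?thesis unfolding L2_norm_def using E real_le_lsqrt by blast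
qed

text \<open>
  Take \<open>N\<^sub>j\<close> to be \<open>x\<^sub>j = (R\<^sub>j / \<theta>) powr (1 / \<alpha>\<^sub>j)\<close> rounded up, which makes each bias at most \<open>\<theta>\<close>. With
  \<open>A = \<Prod>j. R\<^sub>j powr (1 / \<alpha>\<^sub>j)\<close> and \<open>a = alpha_bar \<alpha>\<close> one has \<open>\<theta> = A powr (a / (2 * a + k))\<close> and
  \<open>\<Sum>j. 1 / \<alpha>\<^sub>j = k / a\<close>, so the product of the \<open>x\<^sub>j\<close> is \<open>A / \<theta> powr (k / a) = \<theta>\<^sup>2\<close>.
\<close>

lemma balanced_grid:
  fixes \<alpha> R :: "real ^ 'n"
  defines "\<theta> \<equiv> R_bar \<alpha> R powr (real CARD('n) / (2 * alpha_bar \<alpha> + real CARD('n)))"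
  assumes \<alpha>: "\<And>j. 0 < \<alpha> $ j" and R: "\<And>j. 0 < R $ j" and R_ge: "\<And>j. \<theta> \<le> R $ j"
  obtains N :: "nat ^ 'n" where "\<And>j. 0 < N $ j"
    "\<And>j. R $ j * real (N $ j) powr (- (\<alpha> $ j)) \<le> \<theta>"
    "(\<Prod>j\<in>UNIV. real (N $ j)) \<le> 2 ^ CARD('n) * \<theta>\<^sup>2"
proof -
  define k where "k = real CARD('n)"
  define a where "a = alpha_bar \<alpha>"
  define A where "A = (\<Prod>j\<in>UNIV. (R $ j) powr (1 / \<alpha> $ j))"
  have k: "0 < k" by (simp add: k_def)
  have A: "0 < A" unfolding A_def using R by (intro prod_pos) (simp add: less_imp_neq[symmetric])
  have S: "0 < (\<Sum>j\<in>UNIV. 1 / \<alpha> $ j)" using \<alpha> by (intro sum_pos) auto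
  have a_def': "a = k / (\<Sum>j\<in>UNIV. 1 / \<alpha> $ j)"
    by (simp add: a_def alpha_bar_def k_def)
  have a: "0 < a" using S k by (simp add: a_def')
  have sum_eq: "(\<Sum>j\<in>UNIV. 1 / \<alpha> $ j) = k / a" using S k by (simp add: a_def')
  have \<theta>: "\<theta> = A powr (a / (2 * a + k))"
    unfolding \<theta>_def R_bar_def A_def[symmetric] a_def[symmetric] k_def[symmetric]
    using k by (simp add: powr_powr)
  have \<theta>0: "0 < \<theta>" using A by (simp add: \<theta>)
  define x where "x j = (R $ j / \<theta>) powr (1 / \<alpha> $ j)" for j
  have x1: "1 \<le> x j" for j
    unfolding x_def using R_ge[of j] \<theta>0 \<alpha>[of j] by (intro ge_one_powr_ge_zero) auto
  define N :: "nat ^ 'n" where "N = (\<chi> j. nat \<lceil>x j\<rceil>)"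
  have N_ge: "x j \<le> real (N $ j)" for j by (simp add: N_def real_nat_ceiling_ge)
  have N_le: "real (N $ j) \<le> 2 * x j" for j
  proof -
    have "real (N $ j) = of_int \<lceil>x j\<rceil>" using x1[of j] by (simp add: N_def)
    then show ?thesis using x1[of j] by linarith
  qed
  show thesis
  proof (rule that[of N])
    fix j
    show "0 < N $ j" using N_ge[of j] x1[of j] by (cases "N $ j") auto
    have "real (N $ j) powr (- (\<alpha> $ j)) \<le> x j powr (- (\<alpha> $ j))"
      using N_ge[of j] x1[of j] \<alpha>[of j] by (intro powr_mono2') auto
    also have "x j powr (- (\<alpha> $ j)) = \<theta> / R $ j"
      unfolding x_def using \<alpha>[of j] R[of j] \<theta>0 by (simp add: powr_powr powr_minus_divide)
    finally have "R $ j * real (N $ j) powr (- (\<alpha> $ j)) \<le> R $ j * (\<theta> / R $ j)"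
      using R[of j] by (intro mult_left_mono) auto
    then show "R $ j * real (N $ j) powr (- (\<alpha> $ j)) \<le> \<theta>" using R[of j] by simp
  next
    have "(\<Prod>j\<in>UNIV. real (N $ j)) \<le> (\<Prod>j\<in>UNIV. 2 * x j)"
      using N_le by (intro prod_mono) auto
    also have "\<dots> = 2 ^ CARD('n) * (\<Prod>j\<in>UNIV. x j)" by (simp add: prod.distrib)
    also have "(\<Prod>j\<in>UNIV. x j) = A / (\<Prod>j\<in>UNIV. \<theta> powr (1 / \<alpha> $ j))"
      unfolding x_def A_def using R \<theta>0 by (simp add: powr_divide less_imp_le prod_dividef)
    also have "(\<Prod>j\<in>UNIV. \<theta> powr (1 / \<alpha> $ j)) = \<theta> powr (k / a)"
      using \<theta>0 by (simp add: powr_sum sum_eq[symmetric])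
    also have "A / \<theta> powr (k / a) = A powr (1 - k / (2 * a + k))"
      using a A by (simp add: \<theta> powr_powr powr_diff)
    also have "1 - k / (2 * a + k) = a / (2 * a + k) + a / (2 * a + k)"
      unfolding add_divide_distrib[symmetric] using a k by (simp add: divide_simps)
    also have "A powr \<dots> = \<theta>\<^sup>2" unfolding powr_add \<theta> power2_eq_square ..
    finally show "(\<Prod>j\<in>UNIV. real (N $ j)) \<le> 2 ^ CARD('n) * \<theta>\<^sup>2" .
  qed
qed

theorem corollary2:
  fixes \<alpha> :: "real ^ 'n"
  assumes "\<forall>j. 0 < \<alpha> $ j"
  shows "\<exists>C::real. \<forall>(R :: real ^ 'n) (s :: real ^ 'n \<Rightarrow> real) (est :: (real ^ 'n) multiset \<Rightarrow> real ^ 'n \<Rightarrow> real).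
    (\<forall>j. 0 < R $ j) \<longrightarrow>
    s \<in> L1_nonneg \<longrightarrow>
    linear_T_estimator grid_models piecewise_poly piecewise_poly_dim (\<lambda>m. real (piecewise_poly_dim m)) est \<longrightarrow>
    (\<lambda>x. sqrt (s x)) \<in> aniso_hoelder \<alpha> R \<longrightarrow>
    (\<forall>j. R $ j \<ge> R_bar \<alpha> R powr (real CARD('n) / (2 * alpha_bar \<alpha> + real CARD('n)))) \<longrightarrow>
    (\<integral>\<^sup>+ X. ennreal ((hell s (est X))\<^sup>2) \<partial>poisson_process (intensity_measure s))
      \<le> ennreal (C * R_bar \<alpha> R powr (2 * real CARD('n) / (2 * alpha_bar \<alpha> + real CARD('n))))"
proof -
  define k where "k = CARD('n)"
  \<comment> \<open>One degree serves all coordinates; the sum is an upper bound for every \<open>\<alpha>\<^sub>j\<close>.\<close>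
  define r where "r = nat \<lceil>\<Sum>j\<in>UNIV. \<alpha> $ j\<rceil>"
  have r: "\<alpha> $ j \<le> real r" for j
  proof -
    have "\<alpha> $ j \<le> (\<Sum>j\<in>UNIV. \<alpha> $ j)"
      using assms by (intro member_le_sum) (auto intro: less_imp_le)
    also have "\<dots> \<le> real r" unfolding r_def by (rule real_nat_ceiling_ge)
    finally show ?thesis .
  qed
  define \<eta> :: "(nat ^ 'n) \<times> nat \<Rightarrow> real" where
    "\<eta> = linear_eta piecewise_poly_dim (\<lambda>m. real (piecewise_poly_dim m))"
  define K where "K = 618 + 2 * risk_const (grid_models :: ((nat ^ 'n) \<times> nat) set) \<eta>"
  define c where "c = lebesgue_bound r ^ k * (real k * (2 * lebesgue_bound r))"
  define d where "d = 84 * 9 / 5 * (real (r + 1) ^ k * 2 ^ k)"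
  have K0: "0 \<le> K" using risk_const_nonneg[of grid_models \<eta>] by (simp add: K_def)
  have c0: "0 \<le> c" using lebesgue_bound_ge_1[of r] by (simp add: c_def)
  show ?thesis
  proof (intro exI[of _ "K * (c\<^sup>2 + d)"] allI impI)
    fix R :: "real ^ 'n" and s :: "real ^ 'n \<Rightarrow> real" and est :: "(real ^ 'n) multiset \<Rightarrow> real ^ 'n \<Rightarrow> real"
    assume R: "\<forall>j. 0 < R $ j" and s: "s \<in> L1_nonneg"
      and est: "linear_T_estimator grid_models piecewise_poly piecewise_poly_dim (\<lambda>m. real (piecewise_poly_dim m)) est"
      and f: "(\<lambda>x. sqrt (s x)) \<in> aniso_hoelder \<alpha> R"
      and R_ge: "\<forall>j. R $ j \<ge> R_bar \<alpha> R powr (real CARD('n) / (2 * alpha_bar \<alpha> + real CARD('n)))"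
    define \<theta> where "\<theta> = R_bar \<alpha> R powr (real CARD('n) / (2 * alpha_bar \<alpha> + real CARD('n)))"
    have \<theta>0: "0 \<le> \<theta>" by (simp add: \<theta>_def)
    have \<theta>_sq: "\<theta>\<^sup>2 = R_bar \<alpha> R powr (2 * real CARD('n) / (2 * alpha_bar \<alpha> + real CARD('n)))"
      by (simp add: \<theta>_def power2_eq_square powr_add[symmetric] add_divide_distrib[symmetric])
    obtain N :: "nat ^ 'n" where N: "\<And>j. 0 < N $ j"
      and bias: "\<And>j. R $ j * real (N $ j) powr (- (\<alpha> $ j)) \<le> \<theta>"
      and size: "(\<Prod>j\<in>UNIV. real (N $ j)) \<le> 2 ^ k * \<theta>\<^sup>2"
      using balanced_grid[of \<alpha> R] assms R R_ge unfolding \<theta>_def k_def by blast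
    obtain v where v: "v \<in> piecewise_poly (N, r)"
      and approx: "\<forall>x\<in>unit_cube. \<bar>sqrt (s x) - v x\<bar> \<le> lebesgue_bound r ^ k *
        (\<Sum>j\<in>UNIV. 2 * lebesgue_bound r * (R $ j * real (N $ j) powr (- (\<alpha> $ j))))"
      using aniso_hoelder_approximation[OF f r N] unfolding k_def by blast
    have "lebesgue_bound r ^ k * (\<Sum>j\<in>UNIV. 2 * lebesgue_bound r * (R $ j * real (N $ j) powr (- (\<alpha> $ j))))
        \<le> lebesgue_bound r ^ k * (\<Sum>j\<in>(UNIV :: 'n set). 2 * lebesgue_bound r * \<theta>)"
      using lebesgue_bound_ge_1[of r] bias by (intro mult_left_mono sum_mono) auto
    also have "\<dots> = c * \<theta>" by (simp add: c_def k_def)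
    finally have "\<And>x. x \<in> unit_cube \<Longrightarrow> \<bar>sqrt (s x) - v x\<bar> \<le> c * \<theta>"
      using approx by (meson order.trans)
    then have "L2_norm (\<lambda>x. sqrt (s x) - v x) \<le> c * \<theta>"
      using c0 \<theta>0 by (intro L2_norm_le_sup) auto
    then have L: "(L2_norm (\<lambda>x. sqrt (s x) - v x))\<^sup>2 \<le> (c * \<theta>)\<^sup>2"
      by (rule power_mono) (simp add: L2_norm_def)
    \<comment> \<open>The weight of a model is its dimension, so the maximum in \<open>linear_eta\<close> is its second entry.\<close>
    have "(\<eta> (N, r))\<^sup>2 = 84 * 9 / 5 * real (piecewise_poly_dim (N, r))"
      by (simp add: \<eta>_def linear_eta_def max_def)
    also have "real (piecewise_poly_dim (N, r)) = real (r + 1) ^ k * (\<Prod>j\<in>UNIV. real (N $ j))"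
      by (simp add: piecewise_poly_dim_def k_def)
    also have "84 * 9 / 5 * (real (r + 1) ^ k * (\<Prod>j\<in>UNIV. real (N $ j))) \<le> 84 * 9 / 5 * (real (r + 1) ^ k * (2 ^ k * \<theta>\<^sup>2))"
      by (intro mult_left_mono size) auto
    finally have \<eta>: "(\<eta> (N, r))\<^sup>2 \<le> d * \<theta>\<^sup>2" by (simp add: d_def mult_ac)
    have m: "(N, r) \<in> grid_models" using N by (auto simp: grid_models_def Suc_le_eq)
    have "(\<integral>\<^sup>+ X. ennreal ((hell s (est X))\<^sup>2) \<partial>poisson_process (intensity_measure s))
      \<le> ennreal (K * ((L2_norm (\<lambda>x. sqrt (s x) - v x))\<^sup>2 + (\<eta> (N, r))\<^sup>2))"
      unfolding K_def \<eta>_def by (rule linear_T_estimator_risk[OF est s m v])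
    also have "\<dots> \<le> ennreal (K * ((c * \<theta>)\<^sup>2 + d * \<theta>\<^sup>2))"
      by (intro ennreal_leI mult_left_mono add_mono L \<eta> K0)
    also have "K * ((c * \<theta>)\<^sup>2 + d * \<theta>\<^sup>2) = K * (c\<^sup>2 + d) * \<theta>\<^sup>2"
      by (simp add: algebra_simps power_mult_distrib)
    finally show "(\<integral>\<^sup>+ X. ennreal ((hell s (est X))\<^sup>2) \<partial>poisson_process (intensity_measure s))
      \<le> ennreal (K * (c\<^sup>2 + d) * R_bar \<alpha> R powr (2 * real CARD('n) / (2 * alpha_bar \<alpha> + real CARD('n))))"
      unfolding \<theta>_sq .
  qed
qed

end
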